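(* Assume that $T_{\mathbb K}:L^2(\mathbf X,dP)\to L^2(\mathbf X,dP)$ is one-to-one, that $d\rho$ is absolutely continuous with respect to $dP$, and that the Radon–Nikodym derivative $\frac{d\rho}{dP}$ is bounded on $\mathbf X$. Then $$\lambda_{m,\rho}\;\le\;\sum_{j\ge m}\lambda_j\,\|\varphi_j\|_\rho^2\qquad\text{for all } m\ge 1 .$$ Moreover, let $X_1,\dots,X_n$ be i.i.d. random samples drawn according to $\rho$, and let $B_n=\frac1n\big[\mathbb K(X_i,X_j)\big]_{1\le i,j\le n}$, with eigenvalues $\lambda_1(B_n)\ge\dots\ge\lambda_n(B_n)\geq 0$. Then for any integer $1\le k\le n$ we have $$\mathcal T_k(B_n)=\mathbb E\Big[\sum_{j\ge k}\lambda_j(B_n)\Big]\;\le\;\sum_{j\ge k}\lambda_{j,\rho}\;\lesssim\;\lambda_k\,\|\varphi_k\|_\rho^2,\qquad\text{whenever}\quad \sum_{i\ge k}\frac{(i-k+1)\,\lambda_i\,\|\varphi_i\|_\rho^2}{\lambda_k\,\|\varphi_k\|_\rho^2}<+\infty .$$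
   Context: Let $d\ge 1$ and let $\mathbf X\subset\mathbb R^d$ be compact. Let $\mathbb K:\mathbf X\times\mathbf X\to\mathbb R$ be a Mercer kernel, i.e. continuous, symmetric and positive definite. Let $dP$ be a probability measure with support $\mathbf X$ and $d\rho$ a probability measure supported on $\mathbf X$. Define $T_{\mathbb K}f(x)=\int_{\mathbf X}\mathbb K(x,y)f(y)\,dP(y)$ on $L^2(\mathbf X,dP)$, and $T_{\mathbb K,\rho}f(x)=\int_{\mathbf X}\mathbb K(x,y)f(y)\,d\rho(y)$ on $L^2(\mathbf X,d\rho)$. Let $\lambda_1\ge\lambda_2\ge\cdots\geq 0$ and $\lambda_{1,\rho}\ge\lambda_{2,\rho}\ge\cdots\ge 0$ be the eigenvalues (with multiplicity, in decreasing order) of $T_{\mathbb K}$ and $T_{\mathbb K,\rho}$ respectively, and let $(\varphi_j)_{j\ge1}$ be the corresponding eigenfunctions of $T_{\mathbb K}$, which are continuous on $\mathbf X$ and, when $T_{\mathbb K}$ is one-to-one, form an orthonormal basis of $L^2(\mathbf X,dP)$. Set $\|\varphi_j\|_\rho^2=\int_{\mathbf X}|\varphi_j(y)|^2\,d\rho(y)$. The expectation is over the sample $X_1,\dots,X_n$, and $\sum_{j\ge k}\lambda_j(B_n)$ runs over $k\le j\le n$. The notation $a\lesssim b$ means $a\le C\,b$ for some constant $C>0$; the bound is meant as a decay estimate in $k$, with $C$ independent of $k$ and $n$.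
   Formalization: For ≲ with C independent of k, finiteness of the sum for each k is not enough (fails for λ_k = k^{-4}, ρ = P); the sums are assumed bounded uniformly over the set of k considered, and C serves all those k. A single k gives the pointwise bound. *)

theory Defs
  imports
    "HOL-Probability.Probability"
    "Jordan_Normal_Form.Char_Poly"
    "HOL-Library.Extended_Nat"
begin

(* Positive definiteness is meant in Mercer's sense: all Gram matrices are positive semidefinite. *)
definition mercer_kernel :: "'a::topological_space set \<Rightarrow> ('a \<Rightarrow> 'a \<Rightarrow> real) \<Rightarrow> bool" where
  "mercer_kernel X K \<longleftrightarrow>
     continuous_on (X \<times> X) (\<lambda>(x, y). K x y) \<and>
     (\<forall>x\<in>X. \<forall>y\<in>X. K x y = K y x) \<and>
     (\<forall>(n::nat) (x :: nat \<Rightarrow> 'a) (c :: nat \<Rightarrow> real). (\<forall>i<n. x i \<in> X) \<longrightarrow>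
        0 \<le> (\<Sum>i<n. \<Sum>j<n. c i * c j * K (x i) (x j)))"

(* The space of such a measure is X itself, so integrals against it only see points of X. *)
definition borel_prob_on :: "'a::topological_space set \<Rightarrow> 'a measure \<Rightarrow> bool" where
  "borel_prob_on X \<mu> \<longleftrightarrow> prob_space \<mu> \<and> sets \<mu> = sets (restrict_space borel X)"

definition measure_support :: "'a::topological_space measure \<Rightarrow> 'a set" where
  "measure_support \<mu> =
     {x \<in> space \<mu>. \<forall>U. open U \<longrightarrow> x \<in> U \<longrightarrow> 0 < emeasure \<mu> (U \<inter> space \<mu>)}"

(* Representatives of the classes in real L^2; equality in L^2 is written as AE equality below. *)
definition L2 :: "'a measure \<Rightarrow> ('a \<Rightarrow> real) set" where
  "L2 \<mu> = {f \<in> borel_measurable \<mu>. integrable \<mu> (\<lambda>x. (f x)\<^sup>2)}"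

definition kernel_op :: "('a \<Rightarrow> 'a \<Rightarrow> real) \<Rightarrow> 'a measure \<Rightarrow> ('a \<Rightarrow> real) \<Rightarrow> 'a \<Rightarrow> real" where
  "kernel_op K \<mu> f x = (\<integral>y. K x y * f y \<partial>\<mu>)"

definition one_to_one_op :: "('a \<Rightarrow> 'a \<Rightarrow> real) \<Rightarrow> 'a measure \<Rightarrow> bool" where
  "one_to_one_op K \<mu> \<longleftrightarrow>
     (\<forall>f\<in>L2 \<mu>. \<forall>g\<in>L2 \<mu>.
        (AE x in \<mu>. kernel_op K \<mu> f x = kernel_op K \<mu> g x) \<longrightarrow> (AE x in \<mu>. f x = g x))"

definition eigenspace :: "('a \<Rightarrow> 'a \<Rightarrow> real) \<Rightarrow> 'a measure \<Rightarrow> real \<Rightarrow> ('a \<Rightarrow> real) set" where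
  "eigenspace K \<mu> t = {f \<in> L2 \<mu>. AE x in \<mu>. kernel_op K \<mu> f x = t * f x}"

(* The dimension of the eigenspace as a subspace of L^2, i.e. modulo AE equality. *)
definition eigen_multiplicity :: "('a \<Rightarrow> 'a \<Rightarrow> real) \<Rightarrow> 'a measure \<Rightarrow> real \<Rightarrow> enat" where
  "eigen_multiplicity K \<mu> t =
     Sup {enat m | m. \<exists>f :: nat \<Rightarrow> 'a \<Rightarrow> real.
       (\<forall>i<m. f i \<in> eigenspace K \<mu> t) \<and>
       (\<forall>c :: nat \<Rightarrow> real. (AE x in \<mu>. (\<Sum>i<m. c i * f i x) = 0) \<longrightarrow> (\<forall>i<m. c i = 0))}"

(* Sequences are indexed from 1 and their value at 0 is irrelevant.  Every positive eigenvalue is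
   listed as often as its multiplicity; if only finitely many entries are positive, the sequence
   continues with zeros (this covers finite-dimensional L^2, e.g. for finite X). *)
definition eigenvalue_seq :: "('a \<Rightarrow> 'a \<Rightarrow> real) \<Rightarrow> 'a measure \<Rightarrow> (nat \<Rightarrow> real) \<Rightarrow> bool" where
  "eigenvalue_seq K \<mu> l \<longleftrightarrow>
     antimono_on {1..} l \<and> (\<forall>j\<ge>1. 0 \<le> l j) \<and>
     (\<forall>t>0. finite {j. 1 \<le> j \<and> l j = t} \<and>
            eigen_multiplicity K \<mu> t = enat (card {j. 1 \<le> j \<and> l j = t}))"

(* Entries with l j = 0 carry no condition.  When the operator is one-to-one, 0 is not an
   eigenvalue, and such entries can only be the padding in the finite-dimensional case. *)
definition eigenfunction_seq ::
  "('a::topological_space \<Rightarrow> 'a \<Rightarrow> real) \<Rightarrow> 'a measure \<Rightarrow> (nat \<Rightarrow> real) \<Rightarrow> (nat \<Rightarrow> 'a \<Rightarrow> real) \<Rightarrow> bool"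
where
  "eigenfunction_seq K \<mu> l \<phi> \<longleftrightarrow>
     (\<forall>j\<ge>1. 0 < l j \<longrightarrow> continuous_on (space \<mu>) (\<phi> j) \<and> \<phi> j \<in> eigenspace K \<mu> (l j)) \<and>
     (\<forall>i\<ge>1. \<forall>j\<ge>1. 0 < l i \<longrightarrow> 0 < l j \<longrightarrow>
        (\<integral>x. \<phi> i x * \<phi> j x \<partial>\<mu>) = (if i = j then 1 else 0))"

definition sq_norm :: "'a measure \<Rightarrow> ('a \<Rightarrow> real) \<Rightarrow> real" where
  "sq_norm \<mu> f = (\<integral>y. \<bar>f y\<bar>\<^sup>2 \<partial>\<mu>)"

definition iid_sample ::
  "'w measure \<Rightarrow> 'a measure \<Rightarrow> nat \<Rightarrow> (nat \<Rightarrow> 'w \<Rightarrow> 'a) \<Rightarrow> bool" where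
  "iid_sample M \<rho> n S \<longleftrightarrow>
     prob_space M \<and>
     prob_space.indep_vars M (\<lambda>_. \<rho>) S {..<n} \<and>
     (\<forall>i<n. distr M \<rho> (S i) = \<rho>)"

definition gram_mat :: "('a \<Rightarrow> 'a \<Rightarrow> real) \<Rightarrow> nat \<Rightarrow> (nat \<Rightarrow> 'a) \<Rightarrow> real mat" where
  "gram_mat K n x = mat n n (\<lambda>(i, j). K (x i) (x j) / real n)"

(* The j-th largest eigenvalue for 1 \<le> j \<le> n of an n by n matrix whose n eigenvalues are all real. *)
definition mat_eigenvalue :: "real mat \<Rightarrow> nat \<Rightarrow> real" where
  "mat_eigenvalue B j = rev (sorted_list_of_multiset (proots (char_poly B))) ! (j - 1)"

definition gram_tail ::
  "('a \<Rightarrow> 'a \<Rightarrow> real) \<Rightarrow> nat \<Rightarrow> (nat \<Rightarrow> 'w \<Rightarrow> 'a) \<Rightarrow> nat \<Rightarrow> 'w \<Rightarrow> real" where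
  "gram_tail K n S k \<omega> = (\<Sum>j = k..n. mat_eigenvalue (gram_mat K n (\<lambda>i. S i \<omega>)) j)"

(* The sum over i \<ge> k of (i - k + 1) l i \<parallel>\<phi> i\<parallel>^2 / (l k \<parallel>\<phi> k\<parallel>^2), reindexed by i = k + p.
   In ennreal a / 0 is infinite for a > 0 and 0 / 0 = 0, so if the denominator vanishes the ratio
   is finite only when the whole tail vanishes. *)
definition decay_ratio ::
  "'a measure \<Rightarrow> (nat \<Rightarrow> real) \<Rightarrow> (nat \<Rightarrow> 'a \<Rightarrow> real) \<Rightarrow> nat \<Rightarrow> ennreal" where
  "decay_ratio \<rho> l \<phi> k =
     (\<Sum>p. ennreal (real (p + 1) * l (k + p) * sq_norm \<rho> (\<phi> (k + p))) /
           ennreal (l k * sq_norm \<rho> (\<phi> k)))"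

end

theory Submission
  imports Defs "HOL-Complex_Analysis.Great_Picard"
begin

text \<open>
  Mercer's theorem on the support of a measure gives \<open>K x y = (\<Sum>j. \<lambda>\<^sub>j \<phi>\<^sub>j x \<phi>\<^sub>j y)\<close>; after removing the
  first \<open>m - 1\<close> terms, a positive semidefinite kernel \<open>Q\<close> remains, whose trace with respect to \<open>\<rho>\<close> is
  \<open>\<Sum>j\<ge>m. \<lambda>\<^sub>j \<parallel>\<phi>\<^sub>j\<parallel>\<^sub>\<rho>\<^sup>2\<close>. The eigenvalue bound is the min-max principle: some combination of the first
  \<open>m\<close> eigenfunctions for \<open>\<rho>\<close> is orthogonal to \<open>\<phi>\<^sub>1, \<dots>, \<phi>\<^bsub>m - 1\<^esub>\<close>, and on it the form of \<open>K\<close> is the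
  form of \<open>Q\<close>, which is at most its trace. For the Gram matrix, apply the expansion to \<open>\<rho>\<close> itself: the matrix
  of the first \<open>k - 1\<close> terms has rank below \<open>k\<close>, so by Ky Fan's principle the tail of the spectrum is at
  most the trace of the remainder, whose expectation is \<open>\<Sum>j\<ge>k. \<lambda>\<^bsub>j,\<rho>\<^esub>\<close>. The last bound is a double sum.

  All \<open>L\<^sup>2\<close> arguments take place in the space of continuous functions on \<open>X\<close>, which contains a version of
  every eigenfunction with positive eigenvalue; no completeness is needed.
\<close>

section \<open>Integral operators on continuous functions\<close>

text \<open>The two measures enter unequally. For \<open>P\<close> continuous eigenfunctions are
  given and the support is all of \<open>X\<close>, so the expansion of \<open>K\<close> holds at
  every point. The support of \<open>\<rho>\<close> may be smaller than \<open>X\<close>, and for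
  \<open>\<rho>\<close> only eigenvalues with multiplicities are given: eigenfunctions must be built
  from these counts, and the expansion holds only at support points, where the sample lies almost
  surely. A multiplicity says how many eigenfunctions a level carries, but not that together they
  exhaust the operator. This comes from maximising the quadratic form on the orthogonal complement
  of the eigenfunctions already listed: a maximum above the next entry would be an eigenvalue for
  which the counts leave no room. The same maximisation, on a finite set of reals with the uniform
  measure, diagonalises the Gram matrix. Series of nonnegative terms are summed in
  \<open>ennreal\<close>, so that convergence need not be settled beforehand. The constant of the
  decay estimate is the supremum of \<open>decay_ratio\<close> over the indices, plus 1.\<close>

lemma discriminant_le:
  fixes A B C :: real
  assumes "\<And>a. 0 \<le> a\<^sup>2 * A + 2 * a * B + C"
  shows "B\<^sup>2 \<le> A * C"
proof (cases "A = 0")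
  case True
  have "B = 0"
  proof (rule ccontr)
    assume "B \<noteq> 0"
    \<comment> \<open>At this witness the remaining linear polynomial has the value -1.\<close>
    then show False
      using assms[of "- (C + 1) / (2 * B)"] True by (simp add: field_simps)
  qed
  then show ?thesis using True by simp
next
  case False
  have "0 \<le> C" using assms[of 0] by simp
  have "0 \<le> A"
  proof (rule ccontr)
    assume "\<not> 0 \<le> A"
    then have A: "A < 0" by simp
    \<comment> \<open>So large that \<open>A * s\<close> outweighs
      \<open>2 * \<bar>B\<bar> + C + 1\<close>; the summand 1 keeps \<open>s\<close> at least 1, so
      that the constant \<open>C\<close> cannot restore the sign.\<close>
    define s where "s = (2 * \<bar>B\<bar> + C + 1) / (- A) + 1"
    have "(2 * \<bar>B\<bar> + C + 1) / (- A) \<ge> 0"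
      using A \<open>0 \<le> C\<close> by (intro divide_nonneg_pos) auto
    then have s: "s \<ge> 1" by (simp add: s_def)
    have "A * s = - (2 * \<bar>B\<bar> + C + 1) + A" using A by (simp add: s_def field_simps)
    have "s\<^sup>2 * A + 2 * s * B + C = s * (A * s + 2 * B) + C"
      by (simp add: power2_eq_square algebra_simps)
    also have "\<dots> = s * (- (2 * \<bar>B\<bar> + C + 1) + A + 2 * B) + C"
      unfolding \<open>A * s = _\<close> by simp
    also have "\<dots> \<le> s * (- (C + 1)) + C"
      using s A by (intro add_right_mono mult_left_mono) auto
    also have "\<dots> \<le> - (C + 1) + C"
      using s \<open>0 \<le> C\<close> mult_right_mono[of 1 s "C + 1"] by (simp add: algebra_simps)
    finally show False using assms[of s] by simp
  qed
  then have "A > 0" using False by simp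
  then show ?thesis using assms[of "- B / A"]
    by (simp add: field_simps power2_eq_square)
qed

lemma squeeze_zero:
  fixes a b :: "nat \<Rightarrow> real"
  assumes "\<And>n. 0 \<le> a n" "\<And>n. a n \<le> b n" "b \<longlonglongrightarrow> 0"
  shows "a \<longlonglongrightarrow> 0"
  using tendsto_sandwich[of "\<lambda>_. 0" a sequentially b 0] assms by simp

lemma square_tendsto_zero:
  fixes a :: "nat \<Rightarrow> real"
  assumes "(\<lambda>n. (a n)\<^sup>2) \<longlonglongrightarrow> 0"
  shows "a \<longlonglongrightarrow> 0"
  using tendsto_real_sqrt[OF assms] by (simp add: tendsto_rabs_zero_iff)

text \<open>Used for \<open>P\<close>, for \<open>\<rho>\<close>, and for the uniform measure on a
  finite set of reals that encodes a Gram matrix. No support condition is included, because the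
  support of \<open>\<rho>\<close> may be a proper subset of \<open>X\<close>.\<close>

locale mercer_space =
  fixes X :: "'a::euclidean_space set" and K :: "'a \<Rightarrow> 'a \<Rightarrow> real" and \<mu> :: "'a measure"
  assumes compact_X: "compact X" and mercer: "mercer_kernel X K" and prob_on: "borel_prob_on X \<mu>"
begin

sublocale prob_space \<mu>
  using prob_on by (simp add: borel_prob_on_def)

abbreviation "T \<equiv> kernel_op K \<mu>"

definition ip :: "('a \<Rightarrow> real) \<Rightarrow> ('a \<Rightarrow> real) \<Rightarrow> real"
  where "ip f g = (\<integral>x. f x * g x \<partial>\<mu>)"

section \<open>Bounds and continuity of the kernel and its operator\<close>

lemma sets_mu: "sets \<mu> = sets (restrict_space borel X)"
  using prob_on by (simp add: borel_prob_on_def)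

lemma space_mu [simp]: "space \<mu> = X"
  using sets_eq_imp_space_eq[OF sets_mu] by (simp add: space_restrict_space)

lemma prob_X [simp]: "prob X = 1"
  using prob_space by simp

lemma X_nonempty: "X \<noteq> {}"
  using not_empty by simp

lemma K_sym: "x \<in> X \<Longrightarrow> y \<in> X \<Longrightarrow> K x y = K y x"
  using mercer by (auto simp: mercer_kernel_def)

lemma K_cont: "continuous_on (X \<times> X) (\<lambda>(x, y). K x y)"
  using mercer by (auto simp: mercer_kernel_def)

lemma K_cont_right [continuous_intros]: "x \<in> X \<Longrightarrow> continuous_on X (K x)"
  by (rule continuous_on_compose2[OF K_cont, of X "\<lambda>y. (x, y)", simplified]) (auto intro!: continuous_intros)

lemma K_cont_diag: "continuous_on X (\<lambda>x. K x x)"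
  by (rule continuous_on_compose2[OF K_cont, of X "\<lambda>y. (y, y)", simplified]) (auto intro!: continuous_intros)

lemma K_diag_nonneg: "x \<in> X \<Longrightarrow> 0 \<le> K x x"
  using mercer unfolding mercer_kernel_def
  by (elim conjE allE[of _ "1::nat"] allE[of _ "\<lambda>_. x"] allE[of _ "\<lambda>_. 1"]) simp

lemma continuous_measurable: "continuous_on X f \<Longrightarrow> f \<in> borel_measurable \<mu>"
  for f :: "'a \<Rightarrow> real"
  using borel_measurable_continuous_on_restrict[of X f] measurable_cong_sets[OF sets_mu refl] by blast

lemma continuous_bounded:
  fixes f :: "'b::topological_space \<Rightarrow> real"
  assumes "continuous_on Y f" "compact Y"
  obtains b where "0 \<le> b" "\<And>x. x \<in> Y \<Longrightarrow> \<bar>f x\<bar> \<le> b"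
proof -
  have "bounded (f ` Y)"
    using assms by (intro compact_imp_bounded compact_continuous_image)
  then obtain b where "b > 0" "\<forall>x\<in>f ` Y. norm x \<le> b"
    by (auto simp: bounded_pos)
  then show thesis by (intro that[of b]) auto
qed

lemma continuous_integrable [intro]:
  fixes f :: "'a \<Rightarrow> real"
  assumes "continuous_on X f" shows "integrable \<mu> f"
proof -
  obtain b where "\<And>x. x \<in> X \<Longrightarrow> \<bar>f x\<bar> \<le> b"
    using continuous_bounded[OF assms compact_X] by metis
  then show ?thesis
    by (intro integrable_const_bound[of _ b] continuous_measurable assms) auto
qed

lemma K_bounded: obtains \<kappa> where "0 \<le> \<kappa>" "\<And>x y. x \<in> X \<Longrightarrow> y \<in> X \<Longrightarrow> \<bar>K x y\<bar> \<le> \<kappa>"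
proof -
  obtain b where "0 \<le> b" "\<And>p. p \<in> X \<times> X \<Longrightarrow> \<bar>case p of (x, y) \<Rightarrow> K x y\<bar> \<le> b"
    using continuous_bounded[OF K_cont compact_Times[OF compact_X compact_X]] by metis
  then show thesis by (intro that[of b]) auto
qed

lemma K_integrable:
  assumes "integrable \<mu> f" "x \<in> X"
  shows "integrable \<mu> (\<lambda>y. K x y * f y)"
proof -
  obtain \<kappa> where \<kappa>: "0 \<le> \<kappa>" "\<And>x y. x \<in> X \<Longrightarrow> y \<in> X \<Longrightarrow> \<bar>K x y\<bar> \<le> \<kappa>"
    using K_bounded by blast
  have [measurable]: "K x \<in> borel_measurable \<mu>" "f \<in> borel_measurable \<mu>"
    using assms by (auto intro!: continuous_measurable K_cont_right)
  have "norm (K x y * f y) \<le> norm (\<kappa> * f y)" if "y \<in> X" for y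
    using \<kappa> assms(2) that by (auto simp: abs_mult intro!: mult_mono)
  moreover have "integrable \<mu> (\<lambda>y. \<kappa> * f y)"
    using assms(1) by simp
  ultimately show ?thesis
    using Bochner_Integration.integrable_bound[of \<mu> "\<lambda>y. \<kappa> * f y" "\<lambda>y. K x y * f y"]
    by force
qed

text \<open>Uniform continuity on the compact square makes the modulus independent of
  \<open>z\<close>; this is the source of the equicontinuity of images under
  \<open>T\<close>.\<close>

lemma K_equicont:
  assumes "0 < e"
  obtains d where "0 < d"
    "\<And>x y z. x \<in> X \<Longrightarrow> y \<in> X \<Longrightarrow> z \<in> X \<Longrightarrow> norm (x - y) < d \<Longrightarrow> \<bar>K x z - K y z\<bar> \<le> e"
proof -
  have "uniformly_continuous_on (X \<times> X) (\<lambda>(x, y). K x y)"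
    using K_cont compact_X by (intro compact_uniformly_continuous compact_Times)
  then obtain d where d: "0 < d" "\<And>p q. p \<in> X \<times> X \<Longrightarrow> q \<in> X \<times> X \<Longrightarrow> dist q p < d \<Longrightarrow>
      dist (case q of (x, y) \<Rightarrow> K x y) (case p of (x, y) \<Rightarrow> K x y) < e"
    using assms unfolding uniformly_continuous_on_def by metis
  show thesis
  proof (rule that[OF d(1)])
    fix x y z assume "x \<in> X" "y \<in> X" "z \<in> X" "norm (x - y) < d"
    then show "\<bar>K x z - K y z\<bar> \<le> e"
      using d(2)[of "(y, z)" "(x, z)"] by (auto simp: dist_Pair_Pair dist_norm)
  qed
qed

lemma T_diff_le:
  assumes "integrable \<mu> f" "x \<in> X" "y \<in> X" "\<And>z. z \<in> X \<Longrightarrow> \<bar>K x z - K y z\<bar> \<le> e"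
  shows "\<bar>T f x - T f y\<bar> \<le> e * (\<integral>z. \<bar>f z\<bar> \<partial>\<mu>)"
proof -
  have "T f x - T f y = (\<integral>z. K x z * f z - K y z * f z \<partial>\<mu>)"
    using assms by (simp add: kernel_op_def K_integrable)
  also have "\<bar>\<dots>\<bar> \<le> (\<integral>z. e * \<bar>f z\<bar> \<partial>\<mu>)"
  proof (rule integral_abs_bound[THEN order_trans], rule integral_mono)
    fix z assume "z \<in> space \<mu>"
    then show "\<bar>K x z * f z - K y z * f z\<bar> \<le> e * \<bar>f z\<bar>"
      using assms(4)[of z] by (auto simp: abs_mult left_diff_distrib[symmetric] intro!: mult_right_mono)
  qed (use assms in \<open>auto intro!: K_integrable Bochner_Integration.integrable_diff integrable_abs\<close>)
  finally show ?thesis by simp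
qed

text \<open>Stated for integrable \<open>f\<close>, so that it applies to a square-integrable
  eigenfunction before a continuous version of it is known.\<close>

lemma T_cont:
  assumes "integrable \<mu> f"
  shows "continuous_on X (T f)"
  unfolding continuous_on_iff
proof (intro ballI allI impI)
  fix x e :: "_" assume "x \<in> X" and e: "(0::real) < e"
  define I where "I = (\<integral>z. \<bar>f z\<bar> \<partial>\<mu>)"
  have "0 \<le> I" by (simp add: I_def)
  then have "0 < e / (I + 1)" using e by auto
  then obtain d where d: "0 < d"
    "\<And>x y z. x \<in> X \<Longrightarrow> y \<in> X \<Longrightarrow> z \<in> X \<Longrightarrow> norm (x - y) < d \<Longrightarrow> \<bar>K x z - K y z\<bar> \<le> e / (I + 1)"
    using K_equicont by metis
  show "\<exists>d>0. \<forall>y\<in>X. dist y x < d \<longrightarrow> dist (T f y) (T f x) < e"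
  proof (intro exI[of _ d] conjI ballI impI d(1))
    fix y assume "y \<in> X" "dist y x < d"
    then have "\<bar>T f y - T f x\<bar> \<le> e / (I + 1) * I"
      unfolding I_def using \<open>x \<in> X\<close> d(2)[of y x] assms
      by (intro T_diff_le) (auto simp: dist_norm I_def[symmetric])
    also have "\<dots> < e" using \<open>0 \<le> I\<close> e by (simp add: field_simps)
    finally show "dist (T f y) (T f x) < e" by (simp add: dist_norm)
  qed
qed

lemma T_cont' [continuous_intros]: "continuous_on X f \<Longrightarrow> continuous_on X (T f)"
  by (auto intro!: T_cont)

lemma T_sum:
  assumes "\<And>i. i \<in> I \<Longrightarrow> integrable \<mu> (f i)" "x \<in> X"
  shows "T (\<lambda>y. \<Sum>i\<in>I. c i * f i y) x = (\<Sum>i\<in>I. c i * T (f i) x)"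
proof -
  have "T (\<lambda>y. \<Sum>i\<in>I. c i * f i y) x = (\<integral>y. (\<Sum>i\<in>I. c i * (K x y * f i y)) \<partial>\<mu>)"
    unfolding kernel_op_def by (simp add: sum_distrib_left algebra_simps)
  also have "\<dots> = (\<Sum>i\<in>I. c i * T (f i) x)"
    using assms by (subst Bochner_Integration.integral_sum)
      (auto simp: kernel_op_def intro!: K_integrable)
  finally show ?thesis .
qed

lemma T_add:
  assumes "integrable \<mu> f" "integrable \<mu> g" "x \<in> X"
  shows "T (\<lambda>y. f y + c * g y) x = T f x + c * T g x"
  \<comment> \<open>The two summands are indexed by the booleans.\<close>
  using T_sum[of "UNIV :: bool set" "\<lambda>b. if b then f else g" x "\<lambda>b. if b then 1 else c"] assms
  by (simp add: UNIV_bool add.commute)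

lemma T_cmult: "T (\<lambda>y. c * g y) = (\<lambda>x. c * T g x)"
  by (simp add: kernel_op_def mult.left_commute fun_eq_iff)

lemma T_cong_AE:
  assumes "f \<in> borel_measurable \<mu>" "g \<in> borel_measurable \<mu>" "AE x in \<mu>. f x = g x" "x \<in> X"
  shows "T f x = T g x"
  unfolding kernel_op_def
proof (rule integral_cong_AE)
  have [measurable]: "K x \<in> borel_measurable \<mu>"
    using assms(4) by (intro continuous_measurable K_cont_right)
  note assms(1,2)[measurable]
  show "(\<lambda>y. K x y * f y) \<in> borel_measurable \<mu>" "(\<lambda>y. K x y * g y) \<in> borel_measurable \<mu>" by auto
qed (use assms in auto)

section \<open>The mean-square inner product\<close>

lemma ip_commute: "ip f g = ip g f"
  by (simp add: ip_def mult.commute)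

lemma ip_cong:
  assumes "\<And>x. x \<in> X \<Longrightarrow> f x = f' x" "\<And>x. x \<in> X \<Longrightarrow> g x = g' x"
  shows "ip f g = ip f' g'"
  unfolding ip_def using assms by (intro Bochner_Integration.integral_cong) auto

lemma ip_add_right:
  assumes "continuous_on X f" "continuous_on X g" "continuous_on X h"
  shows "ip h (\<lambda>x. f x + c * g x) = ip h f + c * ip h g"
proof -
  have "ip h (\<lambda>x. f x + c * g x) = (\<integral>x. h x * f x + c * (h x * g x) \<partial>\<mu>)"
    by (simp add: ip_def algebra_simps)
  also have "\<dots> = ip h f + c * ip h g"
    using assms by (subst Bochner_Integration.integral_add) (auto simp: ip_def intro!: continuous_intros)
  finally show ?thesis .
qed

lemma ip_add_left:
  assumes "continuous_on X f" "continuous_on X g" "continuous_on X h"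
  shows "ip (\<lambda>x. f x + c * g x) h = ip f h + c * ip g h"
  using ip_add_right[OF assms, of c] by (simp add: ip_commute)

lemma ip_sum_right:
  assumes "\<And>i. i \<in> I \<Longrightarrow> continuous_on X (f i)" "continuous_on X h"
  shows "ip h (\<lambda>x. \<Sum>i\<in>I. c i * f i x) = (\<Sum>i\<in>I. c i * ip h (f i))"
proof -
  have "ip h (\<lambda>x. \<Sum>i\<in>I. c i * f i x) = (\<integral>x. (\<Sum>i\<in>I. c i * (h x * f i x)) \<partial>\<mu>)"
    by (simp add: ip_def sum_distrib_left algebra_simps)
  also have "\<dots> = (\<Sum>i\<in>I. c i * ip h (f i))"
    using assms by (subst Bochner_Integration.integral_sum) (auto simp: ip_def intro!: continuous_intros)
  finally show ?thesis .
qed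

lemma ip_cmult [simp]: "ip (\<lambda>x. c * f x) g = c * ip f g" "ip f (\<lambda>x. c * g x) = c * ip f g"
  unfolding ip_def integral_mult_right_zero[symmetric] by (simp_all add: mult_ac)

lemma ip_nonneg [simp]: "0 \<le> ip f f"
  by (auto simp: ip_def)

lemma ip_add_self:
  assumes "continuous_on X f" "continuous_on X g"
  shows "ip (\<lambda>x. f x + c * g x) (\<lambda>x. f x + c * g x) = ip f f + 2 * c * ip f g + c\<^sup>2 * ip g g"
  using assms
  by (simp add: ip_add_left ip_add_right continuous_intros power2_eq_square algebra_simps ip_commute[of g f])

text \<open>The cross term is absorbed by the positivity of the square of
  \<open>f - g\<close>.\<close>

lemma ip_add_le:
  assumes "continuous_on X f" "continuous_on X g"
  shows "ip (\<lambda>x. f x + g x) (\<lambda>x. f x + g x) \<le> 2 * ip f f + 2 * ip g g"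
  using ip_add_self[OF assms, of 1] ip_add_self[OF assms, of "-1"]
    ip_nonneg[of "\<lambda>x. f x + - 1 * g x"] by simp

lemma ip_cauchy_schwarz:
  assumes "continuous_on X f" "continuous_on X g"
  shows "(ip f g)\<^sup>2 \<le> ip f f * ip g g"
proof (rule discriminant_le)
  fix a :: real
  have "0 \<le> ip (\<lambda>x. g x + a * f x) (\<lambda>x. g x + a * f x)" by simp
  also have "\<dots> = a\<^sup>2 * ip f f + 2 * a * ip f g + ip g g"
    using ip_add_self[OF assms(2,1), of a] by (simp add: ip_commute[of g f])
  finally show "0 \<le> a\<^sup>2 * ip f f + 2 * a * ip f g + ip g g" .
qed

lemma ip_le_sup:
  assumes "continuous_on X h" "\<And>x. x \<in> X \<Longrightarrow> \<bar>h x\<bar> \<le> e"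
  shows "ip h h \<le> e\<^sup>2"
proof -
  have "ip h h \<le> (\<integral>x. e\<^sup>2 \<partial>\<mu>)"
    unfolding ip_def
  proof (rule integral_mono)
    fix x assume "x \<in> space \<mu>"
    then show "h x * h x \<le> e\<^sup>2"
      using power_mono[OF assms(2)[of x], of 2] by (simp add: power2_eq_square)
  qed (use assms in \<open>auto intro!: continuous_intros\<close>)
  then show ?thesis by (simp add: prob_space)
qed

lemma integral_abs_le:
  assumes "continuous_on X f"
  shows "(\<integral>x. \<bar>f x\<bar> \<partial>\<mu>)\<^sup>2 \<le> ip f f"
  using ip_cauchy_schwarz[of "\<lambda>_. 1" "\<lambda>x. \<bar>f x\<bar>"] assms
  by (simp add: ip_def continuous_intros prob_space)

lemma T_square_le:
  assumes "continuous_on X f" "x \<in> X" "\<And>y. y \<in> X \<Longrightarrow> \<bar>K x y\<bar> \<le> \<kappa>"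
  shows "(T f x)\<^sup>2 \<le> \<kappa>\<^sup>2 * ip f f"
proof -
  have "T f x = ip (K x) f" by (simp add: kernel_op_def ip_def)
  then have "(T f x)\<^sup>2 \<le> ip (K x) (K x) * ip f f"
    using ip_cauchy_schwarz assms K_cont_right by metis
  also have "\<dots> \<le> \<kappa>\<^sup>2 * ip f f"
    using assms K_cont_right by (intro mult_right_mono ip_le_sup) auto
  finally show ?thesis .
qed

text \<open>Borel sets of the product type are generated by products of Borel sets, whereas
  \<open>\<mu>\<close> only knows subsets of \<open>X\<close>. Extension by 0 off the compact square
  moves the question to the whole space.\<close>

lemma continuous_measurable_pair:
  fixes f :: "'a \<times> 'a \<Rightarrow> real"
  assumes "continuous_on (X \<times> X) f"
  shows "f \<in> borel_measurable (\<mu> \<Otimes>\<^sub>M \<mu>)"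
proof -
  define g where "g p = (if p \<in> X \<times> X then f p else 0)" for p
  have "X \<times> X \<in> sets borel"
    using compact_X by (intro borel_compact compact_Times)
  then have "g \<in> borel_measurable borel"
    using borel_measurable_continuous_on_if[of "X \<times> X" f "\<lambda>_. 0"] assms
    unfolding g_def by simp
  moreover have id: "(\<lambda>x. x) \<in> measurable \<mu> borel"
    using measurable_cong_sets[OF sets_mu refl] measurable_restrict_space1[of "\<lambda>x. x" borel borel X] by auto
  have "(\<lambda>p. (fst p, snd p)) \<in> measurable (\<mu> \<Otimes>\<^sub>M \<mu>) (borel \<Otimes>\<^sub>M borel)"
    by (intro measurable_Pair measurable_compose[OF measurable_fst id] measurable_compose[OF measurable_snd id])
  ultimately have "g \<in> borel_measurable (\<mu> \<Otimes>\<^sub>M \<mu>)"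
    by (simp add: borel_prod measurable_compose[of "\<lambda>p. p"])
  then show ?thesis
    by (subst measurable_cong[of _ _ g]) (auto simp: g_def space_pair_measure)
qed

text \<open>Fubini, whose integrand is bounded because it is continuous on a compact set, and the
  symmetry of the kernel.\<close>

lemma T_selfadjoint:
  assumes "continuous_on X f" "continuous_on X g"
  shows "ip (T f) g = ip f (T g)"
proof -
  interpret pair_prob_space \<mu> \<mu> ..
  define k where "k = (\<lambda>(x, y). K x y * f y * g x)"
  have "continuous_on (X \<times> X) (\<lambda>p. (case p of (x, y) \<Rightarrow> K x y) * f (snd p) * g (fst p))"
    using continuous_on_compose2[OF assms(1) continuous_on_snd[OF continuous_on_id, of "X \<times> X"]]
      continuous_on_compose2[OF assms(2) continuous_on_fst[OF continuous_on_id, of "X \<times> X"]]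
    by (intro continuous_on_mult K_cont) auto
  then have c: "continuous_on (X \<times> X) k"
    by (simp add: case_prod_unfold k_def)
  obtain b where b: "0 \<le> b" "\<And>p. p \<in> X \<times> X \<Longrightarrow> \<bar>k p\<bar> \<le> b"
    using continuous_bounded[OF c compact_Times[OF compact_X compact_X]] by blast
  have int: "integrable (\<mu> \<Otimes>\<^sub>M \<mu>) k"
  proof (rule P.integrable_const_bound[OF AE_I2 continuous_measurable_pair[OF c]])
    fix p assume "p \<in> space (\<mu> \<Otimes>\<^sub>M \<mu>)"
    then show "norm (k p) \<le> b" using b(2)[of p] by (simp add: space_pair_measure)
  qed
  have "ip (T f) g = (\<integral>x. \<integral>y. k (x, y) \<partial>\<mu> \<partial>\<mu>)"
    unfolding ip_def kernel_op_def by (simp add: k_def)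
  also have "\<dots> = (\<integral>y. \<integral>x. k (x, y) \<partial>\<mu> \<partial>\<mu>)"
    using Fubini_integral[of "\<lambda>x y. k (x, y)"] int by simp
  also have "\<dots> = ip f (T g)"
    unfolding ip_def kernel_op_def
    by (auto simp: k_def K_sym mult_ac simp flip: integral_mult_right_zero intro!: Bochner_Integration.integral_cong)
  finally show ?thesis .
qed

section \<open>Positivity of the integral operator\<close>

lemma psd_points:
  fixes n :: nat
  assumes "\<And>i. i < n \<Longrightarrow> x i \<in> X"
  shows "0 \<le> (\<Sum>i<n. \<Sum>j<n. c i * c j * K (x i) (x j))"
proof -
  have "\<forall>(n::nat) x c. (\<forall>i<n. x i \<in> X) \<longrightarrow> 0 \<le> (\<Sum>i<n. \<Sum>j<n. c i * c j * K (x i) (x j))"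
    using mercer unfolding mercer_kernel_def by blast
  from this[rule_format, of n x c] assms show ?thesis by simp
qed

text \<open>
  Integrated positivity is obtained by adding point masses \<open>h z / N\<close> at \<open>N\<close> points \<open>z\<close> and averaging
  over each \<open>z\<close> in turn; the diagonal terms contribute an error of order \<open>1 / N\<close>.
\<close>

lemma psd_average:
  fixes n :: nat and x :: "nat \<Rightarrow> 'a" and c :: "nat \<Rightarrow> real"
  assumes h: "continuous_on X h" and N: "0 < N" and x: "\<And>i. i < n \<Longrightarrow> x i \<in> X"
  defines "W \<equiv> ip (T h) h" and "D \<equiv> (\<integral>z. (h z)\<^sup>2 * K z z \<partial>\<mu>)"
  shows "0 \<le> (\<Sum>i<n. \<Sum>j<n. c i * c j * K (x i) (x j)) + 2 * (real p / N) * (\<Sum>i<n. c i * T h (x i))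
    + (real p / N)\<^sup>2 * W + real p / N\<^sup>2 * (D - W)"
  using x
proof (induction p arbitrary: n x c)
  case 0
  then show ?case using psd_points[of n x c] by simp
next
  case (Suc p)
  define q where "q = (\<Sum>i<n. \<Sum>j<n. c i * c j * K (x i) (x j))"
  define L where "L = (\<Sum>i<n. c i * T h (x i))"
  \<comment> \<open>The bound after \<open>p\<close> averaged points. Of their
    \<open>p\<^sup>2\<close> ordered pairs the \<open>p\<close> diagonal ones contribute
    \<open>D\<close> and the others \<open>W\<close>, each with weight
    \<open>1 / N\<^sup>2\<close>.\<close>
  define A where "A = q + 2 * (real p / N) * L + (real p / N)\<^sup>2 * W + real p / N\<^sup>2 * (D - W)"
  define F where "F z = A + (2 / N) * (\<Sum>i<n. c i * (K (x i) z * h z)) + (1 / N\<^sup>2) * ((h z)\<^sup>2 * K z z)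
    + (2 * real p / N\<^sup>2) * (T h z * h z)" for z
  have "0 \<le> F z" if z: "z \<in> X" for z
  proof -
    \<comment> \<open>The point \<open>z\<close> joins with weight \<open>h z / N\<close>, and the
      induction hypothesis is applied to \<open>n + 1\<close> points.\<close>
    let ?x = "x(n := z)" and ?c = "c(n := h z / N)"
    have "(\<Sum>i<Suc n. \<Sum>j<Suc n. ?c i * ?c j * K (?x i) (?x j))
      = q + (\<Sum>i<n. c i * (h z / N) * K (x i) z) + ((\<Sum>j<n. (h z / N) * c j * K z (x j))
        + (h z / N) * (h z / N) * K z z)"
      by (simp add: q_def sum.distrib)
    also have "(\<Sum>j<n. (h z / N) * c j * K z (x j)) = (\<Sum>i<n. c i * (h z / N) * K (x i) z)"
      using z Suc.prems by (intro sum.cong) (auto simp: K_sym)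
    also have "(\<Sum>i<n. c i * (h z / N) * K (x i) z) = (1 / N) * (\<Sum>i<n. c i * (K (x i) z * h z))"
      by (simp add: sum_distrib_left mult_ac)
    finally have 1: "(\<Sum>i<Suc n. \<Sum>j<Suc n. ?c i * ?c j * K (?x i) (?x j))
      = q + (2 / N) * (\<Sum>i<n. c i * (K (x i) z * h z)) + (1 / N\<^sup>2) * ((h z)\<^sup>2 * K z z)"
      by (simp add: power2_eq_square)
    have 2: "(\<Sum>i<Suc n. ?c i * T h (?x i)) = L + (h z / N) * T h z"
      by (simp add: L_def)
    have "0 \<le> (\<Sum>i<Suc n. \<Sum>j<Suc n. ?c i * ?c j * K (?x i) (?x j))
      + 2 * (real p / N) * (\<Sum>i<Suc n. ?c i * T h (?x i)) + (real p / N)\<^sup>2 * W + real p / N\<^sup>2 * (D - W)"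
      using Suc.prems z by (intro Suc.IH) (auto simp: less_Suc_eq)
    then show "0 \<le> F z"
      unfolding 1 2 F_def A_def by (simp add: divide_inverse algebra_simps power2_eq_square)
  qed
  then have "0 \<le> (\<integral>z. F z \<partial>\<mu>)"
    by (intro Bochner_Integration.integral_nonneg) auto
  also have "\<dots> = A + (2 / N) * L + (1 / N\<^sup>2) * D + (2 * real p / N\<^sup>2) * W"
  proof -
    have [simp]: "integrable \<mu> (\<lambda>z. K (x i) z * h z)" if "i < n" for i
      using Suc.prems that h K_integrable[OF continuous_integrable[OF h]] by simp
    have [simp]: "integrable \<mu> (\<lambda>z. (h z)\<^sup>2 * K z z)" "integrable \<mu> (\<lambda>z. T h z * h z)"
      using h K_cont_diag by (auto intro!: continuous_intros)
    define S where "S z = (\<Sum>i<n. c i * (K (x i) z * h z))" for z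
    have [simp]: "integrable \<mu> S"
      unfolding S_def by (intro Bochner_Integration.integrable_sum) simp
    have "(\<integral>z. S z \<partial>\<mu>) = L"
      unfolding S_def by (subst Bochner_Integration.integral_sum) (auto simp: L_def kernel_op_def)
    then show ?thesis
      unfolding F_def D_def W_def ip_def S_def[symmetric] by simp
  qed
  finally have "0 \<le> A + (2 / N) * L + (1 / N\<^sup>2) * D + (2 * real p / N\<^sup>2) * W" .
  also have "\<dots> = q + 2 * (real (Suc p) / N) * L + (real (Suc p) / N)\<^sup>2 * W + real (Suc p) / N\<^sup>2 * (D - W)"
    using N by (simp add: A_def field_simps power2_eq_square)
  finally show ?case unfolding q_def L_def .
qed

text \<open>The right-hand side is the quadratic form of \<open>K\<close> on the signed measure with
  mass \<open>a\<close> at \<open>x\<close> and density \<open>h\<close>. Averaging over all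
  \<open>N\<close> added points leaves an error of order \<open>1 / N\<close>.\<close>

lemma T_psd:
  assumes "continuous_on X h" "x \<in> X"
  shows "0 \<le> a\<^sup>2 * K x x + 2 * a * T h x + ip (T h) h"
proof -
  define D where "D = (\<integral>z. (h z)\<^sup>2 * K z z \<partial>\<mu>)"
  define R where "R = a\<^sup>2 * K x x + 2 * a * T h x + ip (T h) h"
  have "0 \<le> R + (D - ip (T h) h) * (1 / real (Suc N))" for N
    using psd_average[OF assms(1), of "real (Suc N)" 1 "\<lambda>_. x" "\<lambda>_. a" "Suc N"] assms(2)
    unfolding D_def R_def
    by (simp add: power2_eq_square field_simps del: of_nat_Suc)
  moreover have "(\<lambda>N. R + (D - ip (T h) h) * (1 / real (Suc N))) \<longlonglongrightarrow> R + (D - ip (T h) h) * 0"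
    by (intro tendsto_intros LIMSEQ_Suc[OF lim_1_over_n])
  ultimately have "0 \<le> R + (D - ip (T h) h) * 0"
    by (intro LIMSEQ_le_const) auto
  then show ?thesis by (simp add: R_def)
qed

lemma T_nonneg: "continuous_on X h \<Longrightarrow> 0 \<le> ip (T h) h"
  using T_psd[of h _ 0] X_nonempty by auto

text \<open>The quadratic polynomial in \<open>a\<close> from \<open>T_psd\<close> is nonnegative.
  Mixing a point mass with a density turns a bound on the form into a bound at every point of
  \<open>X\<close>, on or off the support.\<close>

lemma T_pointwise: "continuous_on X h \<Longrightarrow> x \<in> X \<Longrightarrow> (T h x)\<^sup>2 \<le> K x x * ip (T h) h"
  by (intro discriminant_le T_psd)

lemma T_cauchy_schwarz:
  assumes "continuous_on X f" "continuous_on X g"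
  shows "(ip (T f) g)\<^sup>2 \<le> ip (T f) f * ip (T g) g"
proof (rule discriminant_le)
  fix a :: real
  have "0 \<le> ip (T (\<lambda>x. g x + a * f x)) (\<lambda>x. g x + a * f x)"
    using assms by (intro T_nonneg continuous_intros)
  also have "\<dots> = ip (\<lambda>x. T g x + a * T f x) (\<lambda>x. g x + a * f x)"
    using assms by (intro ip_cong) (auto intro!: T_add)
  also have "\<dots> = a\<^sup>2 * ip (T f) f + 2 * a * ip (T f) g + ip (T g) g"
    using assms T_selfadjoint[OF assms] ip_commute[of f "T g"]
    by (simp add: ip_add_left ip_add_right continuous_intros power2_eq_square algebra_simps)
  finally show "0 \<le> a\<^sup>2 * ip (T f) f + 2 * a * ip (T f) g + ip (T g) g" .
qed

lemma T_form_le: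
  assumes f: "continuous_on X f" and \<kappa>: "0 \<le> \<kappa>" "\<And>x y. x \<in> X \<Longrightarrow> y \<in> X \<Longrightarrow> \<bar>K x y\<bar> \<le> \<kappa>"
  shows "ip (T f) f \<le> \<kappa> * ip f f"
proof -
  have "(ip (T f) f)\<^sup>2 \<le> ip (T f) (T f) * ip f f"
    using f by (intro ip_cauchy_schwarz continuous_intros)
  also have "\<dots> \<le> (\<kappa> * sqrt (ip f f))\<^sup>2 * ip f f"
  proof (intro mult_right_mono ip_le_sup continuous_intros f)
    fix x assume "x \<in> X"
    have "(T f x)\<^sup>2 \<le> (\<kappa> * sqrt (ip f f))\<^sup>2"
      using T_square_le[OF f \<open>x \<in> X\<close>, of \<kappa>] \<kappa>(2) \<open>x \<in> X\<close> by (simp add: power_mult_distrib)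
    then show "\<bar>T f x\<bar> \<le> \<kappa> * sqrt (ip f f)"
      using \<kappa>(1) by (intro power2_le_imp_le[of "\<bar>T f x\<bar>"]) auto
  qed auto
  also have "\<dots> = (\<kappa> * ip f f)\<^sup>2"
    by (simp add: power2_eq_square)
  finally show ?thesis
    by (rule power2_le_imp_le) (use \<kappa>(1) in auto)
qed

text \<open>
  Along a maximising sequence for the form the images under \<open>T\<close> are equicontinuous, and a uniform limit
  point of them is an eigenfunction.
\<close>

lemma rayleigh_max:
  fixes J :: "'j set" and v :: "'j \<Rightarrow> 'a \<Rightarrow> real" and e :: "'j \<Rightarrow> real"
  assumes v: "\<And>j. j \<in> J \<Longrightarrow> continuous_on X (v j)"
    and ev: "\<And>j x. j \<in> J \<Longrightarrow> x \<in> X \<Longrightarrow> T (v j) x = e j * v j x"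
  defines "H \<equiv> {f. continuous_on X f \<and> (\<forall>j\<in>J. ip (v j) f = 0)}"
  assumes f0: "f0 \<in> H" "0 < ip (T f0) f0"
  obtains g t where "g \<in> H" "ip g g = 1" "0 < t" "\<And>x. x \<in> X \<Longrightarrow> T g x = t * g x"
    "\<And>f. f \<in> H \<Longrightarrow> ip (T f) f \<le> t * ip f f"
proof -
  obtain \<kappa> where \<kappa>: "0 \<le> \<kappa>" "\<And>x y. x \<in> X \<Longrightarrow> y \<in> X \<Longrightarrow> \<bar>K x y\<bar> \<le> \<kappa>"
    using K_bounded by blast
  have Hc: "continuous_on X f" if "f \<in> H" for f using that by (simp add: H_def)
  \<comment> \<open>A self-adjoint operator preserves the orthogonal complement of its
    eigenfunctions.\<close>
  have H_T: "T f \<in> H" if "f \<in> H" for f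
  proof -
    have "ip (v j) (T f) = 0" if j: "j \<in> J" for j
    proof -
      have "ip (v j) (T f) = ip (T (v j)) f"
        using v[OF j] Hc[OF \<open>f \<in> H\<close>] by (simp add: T_selfadjoint)
      also have "\<dots> = ip (\<lambda>x. e j * v j x) f"
        using ev[OF j] by (intro ip_cong) auto
      finally show ?thesis using \<open>f \<in> H\<close> j by (simp add: H_def)
    qed
    then show ?thesis using Hc[OF that] by (auto simp: H_def intro!: continuous_intros)
  qed
  have H_cmult: "(\<lambda>x. c * f x) \<in> H" if "f \<in> H" for f c
    using that by (auto simp: H_def intro!: continuous_intros)
  have form_cmult: "ip (T (\<lambda>x. c * f x)) (\<lambda>x. c * f x) = c\<^sup>2 * ip (T f) f" for c f
    by (simp add: T_cmult power2_eq_square)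
  \<comment> \<open>The unit ball rather than the sphere: 0 is then a member, which gives
    nonemptiness and \<open>0 \<le> t\<close> at once.\<close>
  define A where "A = {ip (T f) f |f. f \<in> H \<and> ip f f \<le> 1}"
  have A_bdd: "a \<le> \<kappa>" if "a \<in> A" for a
  proof -
    obtain f where f: "a = ip (T f) f" "f \<in> H" "ip f f \<le> 1" using \<open>a \<in> A\<close> by (auto simp: A_def)
    have "a \<le> \<kappa> * ip f f" using T_form_le[OF Hc[OF f(2)] \<kappa>] f(1) by simp
    also have "\<dots> \<le> \<kappa>" using f(3) \<kappa>(1) by (simp add: mult_left_le)
    finally show ?thesis .
  qed
  then have bdd: "bdd_above A" by (auto simp: bdd_above_def)
  have A0: "0 \<in> A"
    using form_cmult[of 0 f0] H_cmult[OF f0(1), of 0] by (auto simp: A_def ip_def intro!: exI[of _ "\<lambda>x. 0 * f0 x"])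
  define t where "t = Sup A"
  have t0: "0 \<le> t" using A0 bdd by (auto simp: t_def intro: cSup_upper)
  have max: "ip (T f) f \<le> t * ip f f" if f: "f \<in> H" for f
  proof (cases "ip f f = 0")
    case True
    then show ?thesis using T_form_le[OF Hc[OF f] \<kappa>] by simp
  next
    case False
    then have pos: "0 < ip f f" using ip_nonneg[of f] by linarith
    let ?c = "1 / sqrt (ip f f)"
    have "ip (\<lambda>x. ?c * f x) (\<lambda>x. ?c * f x) = 1"
      using pos by (simp only: ip_cmult) (simp add: field_simps)
    then have "ip (T (\<lambda>x. ?c * f x)) (\<lambda>x. ?c * f x) \<in> A"
      using H_cmult[OF f, of ?c] unfolding A_def by (intro CollectI exI[of _ "\<lambda>x. ?c * f x"]) auto
    then have "?c\<^sup>2 * ip (T f) f \<le> t"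
      unfolding form_cmult t_def by (rule cSup_upper) (rule bdd)
    then show ?thesis using pos by (simp add: power_divide field_simps)
  qed
  have t_pos: "0 < t"
    using max[OF f0(1)] f0(2) t0 by (cases "t = 0") auto
  have "\<exists>f. f \<in> H \<and> ip f f \<le> 1 \<and> t - 1 / real (Suc n) < ip (T f) f" for n
  proof -
    have "t - 1 / real (Suc n) < Sup A" by (simp add: t_def)
    then obtain a where "a \<in> A" "t - 1 / real (Suc n) < a"
      using less_cSupE A0 by (metis empty_iff)
    then show ?thesis by (auto simp: A_def)
  qed
  then obtain F where F: "\<And>n. F n \<in> H" "\<And>n. ip (F n) (F n) \<le> 1"
    "\<And>n. t - 1 / real (Suc n) < ip (T (F n)) (F n)"
    by metis
  note Fc = Hc[OF F(1)]
  have TFc: "continuous_on X (T (F n))" for n by (intro continuous_intros Fc)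
  have residual: "ip (\<lambda>x. T (F n) x + (- t) * F n x) (\<lambda>x. T (F n) x + (- t) * F n x) \<le> t / real (Suc n)" for n
  proof -
    let ?s = "ip (T (F n)) (T (F n))" and ?w = "ip (T (F n)) (F n)"
    \<comment> \<open>Cauchy-Schwarz for the form of \<open>T\<close>, applied to \<open>F n\<close>
      and \<open>T (F n)\<close>, is combined with the bound by \<open>t\<close> at
      \<open>T (F n)\<close>. The outcome \<open>?s \<le> t * ?w\<close> turns near-maximality of
      the form into a small residual \<open>T (F n) - t F n\<close>.\<close>
    have "?s\<^sup>2 \<le> ?w * ip (T (T (F n))) (T (F n))"
      by (intro T_cauchy_schwarz Fc TFc)
    also have "\<dots> \<le> ?w * (t * ?s)"
      by (intro mult_left_mono max H_T F T_nonneg Fc t0)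
    finally have "?s * ?s \<le> ?s * (t * ?w)" by (simp add: power2_eq_square mult_ac)
    then have s: "?s \<le> t * ?w"
      using t_pos T_nonneg[OF Fc, of n] ip_nonneg[of "T (F n)"]
      by (cases "?s = 0") (auto simp: mult_le_cancel_left)
    have "ip (\<lambda>x. T (F n) x + (- t) * F n x) (\<lambda>x. T (F n) x + (- t) * F n x)
      = ?s - 2 * t * ?w + t\<^sup>2 * ip (F n) (F n)"
      by (simp only: ip_add_left ip_add_right continuous_intros TFc Fc ip_commute[of "F n" "T (F n)"])
        (simp add: algebra_simps power2_eq_square)
    also have "\<dots> \<le> t * ?w - 2 * t * ?w + t\<^sup>2 * 1"
      by (intro add_mono diff_right_mono mult_left_mono s F) auto
    also have "\<dots> = t * (t - ?w)" by (simp add: power2_eq_square algebra_simps)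
    also have "\<dots> \<le> t * (1 / real (Suc n))"
      using F(3)[of n] by (intro mult_left_mono t0) linarith
    finally show ?thesis by simp
  qed
  have F_abs: "(\<integral>z. \<bar>F n z\<bar> \<partial>\<mu>) \<le> 1" for n
  proof (rule power2_le_imp_le)
    show "(\<integral>z. \<bar>F n z\<bar> \<partial>\<mu>)\<^sup>2 \<le> 1\<^sup>2"
      using order_trans[OF integral_abs_le[OF Fc, of n] F(2)[of n]] by simp
  qed simp
  have "\<exists>g k. continuous_on X g \<and> strict_mono (k :: nat \<Rightarrow> nat) \<and>
      (\<forall>e>0. \<exists>N. \<forall>n x. n \<ge> N \<and> x \<in> X \<longrightarrow> norm (T (F (k n)) x - g x) < e)"
  proof (rule Arzela_Ascoli[OF compact_X, of "\<lambda>n. T (F n)" \<kappa>])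
    fix n x assume "x \<in> X"
    have "(T (F n) x)\<^sup>2 \<le> \<kappa>\<^sup>2 * ip (F n) (F n)"
      using \<kappa> \<open>x \<in> X\<close> by (intro T_square_le Fc)
    also have "\<dots> \<le> \<kappa>\<^sup>2" using F(2) by (intro mult_left_le) auto
    finally show "norm (T (F n) x) \<le> \<kappa>"
      using \<kappa>(1) by (intro power2_le_imp_le[of "norm (T (F n) x)"]) auto
  next
    fix x e :: "_" assume "x \<in> X" and e: "(0::real) < e"
    then obtain d where d: "0 < d"
      "\<And>x y z. x \<in> X \<Longrightarrow> y \<in> X \<Longrightarrow> z \<in> X \<Longrightarrow> norm (x - y) < d \<Longrightarrow> \<bar>K x z - K y z\<bar> \<le> e / 2"
      using K_equicont[of "e / 2"] by auto
    show "\<exists>d>0. \<forall>n y. y \<in> X \<and> norm (x - y) < d \<longrightarrow> norm (T (F n) x - T (F n) y) < e"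
    proof (intro exI[of _ d] conjI allI impI d(1))
      fix n y assume y: "y \<in> X \<and> norm (x - y) < d"
      have "\<bar>T (F n) x - T (F n) y\<bar> \<le> (e / 2) * (\<integral>z. \<bar>F n z\<bar> \<partial>\<mu>)"
        using y \<open>x \<in> X\<close> d(2) Fc by (intro T_diff_le) auto
      also have "\<dots> \<le> e / 2" using F_abs[of n] e by (intro mult_left_le) auto
      finally show "norm (T (F n) x - T (F n) y) < e" using e by simp
    qed
  qed blast
  then obtain g k where g: "continuous_on X g" and k: "strict_mono (k :: nat \<Rightarrow> nat)"
    and lim: "\<And>e. 0 < e \<Longrightarrow> \<exists>N. \<forall>n x. n \<ge> N \<and> x \<in> X \<longrightarrow> norm (T (F (k n)) x - g x) < e"
    by blast
  define G where "G n = F (k n)" for n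
  have Gc: "continuous_on X (G n)" for n by (simp add: G_def Fc)
  have TGc: "continuous_on X (T (G n))" for n by (simp add: G_def TFc)
  \<comment> \<open>The images converge uniformly, but the sequence itself only in mean: that
    \<open>d n\<close> tends to 0 says that \<open>t * G n\<close> approaches
    \<open>g\<close>.\<close>
  define d where "d n x = g x + (- t) * G n x" for n x
  have dc: "continuous_on X (d n)" for n
    unfolding d_def by (intro continuous_intros g Gc)
  have T_lim: "(\<lambda>n. T (G n) x) \<longlonglongrightarrow> g x" if "x \<in> X" for x
    using lim that unfolding LIMSEQ_iff G_def by blast
  have diff_lim: "(\<lambda>n. ip (\<lambda>x. g x + (-1) * T (G n) x) (\<lambda>x. g x + (-1) * T (G n) x)) \<longlonglongrightarrow> 0"
    unfolding LIMSEQ_iff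
  proof (intro allI impI)
    fix r :: real assume "0 < r"
    then obtain N where N: "\<And>n x. n \<ge> N \<Longrightarrow> x \<in> X \<Longrightarrow> \<bar>T (G n) x - g x\<bar> < sqrt (r / 2)"
      using lim[of "sqrt (r / 2)"] by (auto simp: G_def)
    have "ip (\<lambda>x. g x + (-1) * T (G n) x) (\<lambda>x. g x + (-1) * T (G n) x) \<le> (sqrt (r / 2))\<^sup>2" if "n \<ge> N" for n
      using N[OF that] by (intro ip_le_sup continuous_intros g TGc) (force simp: abs_minus_commute)
    then show "\<exists>N. \<forall>n\<ge>N. norm (ip (\<lambda>x. g x + (-1) * T (G n) x) (\<lambda>x. g x + (-1) * T (G n) x) - 0) < r"
      using \<open>0 < r\<close> by (intro exI[of _ N]) force
  qed
  have d_lim: "(\<lambda>n. ip (d n) (d n)) \<longlonglongrightarrow> 0"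
  proof (rule squeeze_zero)
    \<comment> \<open>\<open>d n\<close> is split into \<open>g - T (G n)\<close> and the residual
      \<open>T (G n) - t G n\<close>.\<close>
    let ?p = "\<lambda>n x. g x + (-1) * T (G n) x" and ?q = "\<lambda>n x. T (G n) x + (- t) * G n x"
    have "ip (d n) (d n) \<le> 2 * ip (?p n) (?p n) + 2 * (t / real (Suc n))" for n
    proof -
      have pc: "continuous_on X (?p n)" and qc: "continuous_on X (?q n)"
        by (intro continuous_intros g TGc Gc)+
      have "ip (d n) (d n) = ip (\<lambda>x. ?p n x + ?q n x) (\<lambda>x. ?p n x + ?q n x)"
        by (simp add: d_def[abs_def])
      also have "\<dots> \<le> 2 * ip (?p n) (?p n) + 2 * ip (?q n) (?q n)"
        by (rule ip_add_le[OF pc qc])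
      also have "ip (?q n) (?q n) \<le> t / real (Suc (k n))"
        using residual[of "k n"] by (simp add: G_def)
      also have "\<dots> \<le> t / real (Suc n)"
        using t_pos seq_suble[OF k, of n] by (intro divide_left_mono) auto
      finally show ?thesis by simp
    qed
    then show "ip (d n) (d n) \<le> 2 * ip (?p n) (?p n) + 2 * (t * (1 / real (Suc n)))" for n
      by simp
    have "(\<lambda>n. 2 * ip (?p n) (?p n) + 2 * (t * (1 / real (Suc n)))) \<longlonglongrightarrow> 2 * 0 + 2 * (t * 0)"
      by (intro tendsto_intros diff_lim LIMSEQ_Suc[OF lim_1_over_n])
    then show "(\<lambda>n. 2 * ip (?p n) (?p n) + 2 * (t * (1 / real (Suc n)))) \<longlonglongrightarrow> 0" by simp
  qed auto
  \<comment> \<open>At each point \<open>T (d n)\<close> tends to 0 and also to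
    \<open>T g - t g\<close>.\<close>
  have Tg: "T g x = t * g x" if x: "x \<in> X" for x
  proof -
    have "(\<lambda>n. (T (d n) x)\<^sup>2) \<longlonglongrightarrow> 0"
    proof (rule squeeze_zero)
      show "(T (d n) x)\<^sup>2 \<le> \<kappa>\<^sup>2 * ip (d n) (d n)" for n
        using \<kappa>(2)[OF x] by (intro T_square_le[OF dc x]) auto
      show "(\<lambda>n. \<kappa>\<^sup>2 * ip (d n) (d n)) \<longlonglongrightarrow> 0"
        using tendsto_mult[OF tendsto_const d_lim, of "\<kappa>\<^sup>2"] by simp
    qed auto
    then have "(\<lambda>n. T (d n) x) \<longlonglongrightarrow> 0"
      by (rule square_tendsto_zero)
    moreover have "T (d n) x = T g x + (- t) * T (G n) x" for n
      unfolding d_def using x g Gc by (intro T_add) auto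
    ultimately have "(\<lambda>n. T g x + (- t) * T (G n) x) \<longlonglongrightarrow> 0" by simp
    moreover have "(\<lambda>n. T g x + (- t) * T (G n) x) \<longlonglongrightarrow> T g x + (- t) * g x"
      by (intro tendsto_intros T_lim x)
    ultimately show ?thesis using LIMSEQ_unique by fastforce
  qed
  have ip_lim: "(\<lambda>n. ip h (d n)) \<longlonglongrightarrow> 0" if h: "continuous_on X h" for h
  proof -
    have "(\<lambda>n. (ip h (d n))\<^sup>2) \<longlonglongrightarrow> 0"
    proof (rule squeeze_zero)
      show "(ip h (d n))\<^sup>2 \<le> ip h h * ip (d n) (d n)" for n
        by (intro ip_cauchy_schwarz h dc)
      show "(\<lambda>n. ip h h * ip (d n) (d n)) \<longlonglongrightarrow> 0"
        using tendsto_mult[OF tendsto_const d_lim, of "ip h h"] by simp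
    qed auto
    then show ?thesis by (rule square_tendsto_zero)
  qed
  have gH: "g \<in> H"
  proof -
    have "ip (v j) g = 0" if j: "j \<in> J" for j
    proof -
      have "ip (v j) (d n) = ip (v j) g" for n
        using F(1)[of "k n"] j unfolding d_def
        by (subst ip_add_right) (auto simp: g Gc v G_def H_def)
      then show ?thesis using ip_lim[OF v[OF j]] by (simp add: LIMSEQ_const_iff)
    qed
    then show ?thesis using g by (simp add: H_def)
  qed
  have g_pos: "0 < ip g g"
  proof (rule ccontr)
    assume "\<not> 0 < ip g g"
    then have g0: "ip g g = 0" using ip_nonneg[of g] by linarith
    \<comment> \<open>If \<open>g\<close> had norm 0, the form of \<open>G n\<close> would tend to
      0, although it is at least \<open>t - 1 / Suc n\<close>.\<close>
    have "(ip (T (G n)) (G n))\<^sup>2 \<le> ip (\<lambda>x. g x + (-1) * T (G n) x) (\<lambda>x. g x + (-1) * T (G n) x)" for n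
    proof -
      have "ip g (G n) = 0"
        using ip_cauchy_schwarz[OF g Gc, of n] g0 by simp
      then have "ip (\<lambda>x. g x + (-1) * T (G n) x) (G n) = - ip (T (G n)) (G n)"
        by (subst ip_add_left) (auto simp: g Gc TGc)
      then have "(ip (T (G n)) (G n))\<^sup>2 \<le>
          ip (\<lambda>x. g x + (-1) * T (G n) x) (\<lambda>x. g x + (-1) * T (G n) x) * ip (G n) (G n)"
        using ip_cauchy_schwarz[of "\<lambda>x. g x + (-1) * T (G n) x" "G n"] g Gc TGc
        by (simp add: continuous_intros)
      also have "\<dots> \<le> ip (\<lambda>x. g x + (-1) * T (G n) x) (\<lambda>x. g x + (-1) * T (G n) x)"
        using F(2)[of "k n"] by (intro mult_left_le) (auto simp: G_def)
      finally show ?thesis .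
    qed
    then have "(\<lambda>n. (ip (T (G n)) (G n))\<^sup>2) \<longlonglongrightarrow> 0"
      by (intro squeeze_zero[OF _ _ diff_lim]) auto
    then have 1: "(\<lambda>n. ip (T (G n)) (G n)) \<longlonglongrightarrow> 0" by (rule square_tendsto_zero)
    have "t - 1 / real (Suc n) \<le> ip (T (G n)) (G n)" for n
    proof -
      have "1 / real (Suc (k n)) \<le> 1 / real (Suc n)"
        using seq_suble[OF k, of n] by (intro divide_left_mono) auto
      then show ?thesis using F(3)[of "k n"] by (simp add: G_def)
    qed
    moreover have "(\<lambda>n. t - 1 / real (Suc n)) \<longlonglongrightarrow> t - 0"
      by (intro tendsto_intros LIMSEQ_Suc[OF lim_1_over_n])
    ultimately have "t - 0 \<le> 0"
      by (intro LIMSEQ_le[OF _ 1]) auto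
    then show False using t_pos by simp
  qed
  let ?c = "1 / sqrt (ip g g)"
  show thesis
  proof (rule that[of "\<lambda>x. ?c * g x" t])
    show "ip (\<lambda>x. ?c * g x) (\<lambda>x. ?c * g x) = 1"
      using g_pos by (simp only: ip_cmult) (simp add: field_simps)
    show "T (\<lambda>x. ?c * g x) x = t * (?c * g x)" if "x \<in> X" for x
      using Tg[OF that] by (simp only: T_cmult) simp
  qed (use H_cmult[OF gH, of ?c] t_pos max in auto)
qed

text \<open>A nonzero value of a continuous function persists on a relatively open set, which has
  positive measure around a support point. This is how mean-square identities become pointwise
  ones.\<close>

lemma zero_on_support:
  assumes h: "continuous_on X h" "ip h h = 0" and y: "y \<in> measure_support \<mu>"
  shows "h y = 0"
proof (rule ccontr)
  assume "h y \<noteq> 0"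
  have "y \<in> X" using y by (auto simp: measure_support_def)
  obtain U where U: "open U" "U \<inter> X = h -` (- {0}) \<inter> X"
    using h(1) unfolding continuous_on_open_invariant by (metis open_Compl closed_singleton)
  have "y \<in> U" using U(2) \<open>h y \<noteq> 0\<close> \<open>y \<in> X\<close> by blast
  then have pos: "0 < emeasure \<mu> (U \<inter> X)"
    using y U(1) by (auto simp: measure_support_def)
  have "integrable \<mu> (\<lambda>x. h x * h x)" using h(1) by (auto intro!: continuous_intros)
  then have "AE x in \<mu>. h x * h x = 0"
    using h(2) by (subst (asm) ip_def, subst (asm) integral_nonneg_eq_0_iff_AE) auto
  then have "AE x in \<mu>. x \<notin> U \<inter> X"
    using U(2) by (auto elim!: eventually_mono)
  moreover have "U \<inter> X \<in> sets \<mu>"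
    using U(1) by (auto simp: sets_mu sets_restrict_space)
  ultimately have "U \<inter> X \<in> null_sets \<mu>"
    by (simp add: AE_iff_null_sets)
  then show False using pos by (simp add: null_sets_def)
qed

lemma open_Int_sets: "open U \<Longrightarrow> U \<inter> X \<in> sets \<mu>"
  unfolding sets_mu sets_restrict_space by (rule image_eqI[of _ _ U]) auto

text \<open>By second countability the complement of the support is covered by countably many basic
  open sets of measure 0.\<close>

lemma AE_support: "AE x in \<mu>. x \<in> measure_support \<mu>"
proof -
  obtain B :: "'a set set" where B: "countable B" "topological_basis B"
    using ex_countable_basis by blast
  define N where "N = {U \<in> B. emeasure \<mu> (U \<inter> X) = 0}"
  have "U \<inter> X \<in> null_sets \<mu>" if "U \<in> N" for U
  proof -
    have "open U" using that B(2) by (auto simp: N_def topological_basis_open)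
    then have "U \<inter> X \<in> sets \<mu>" by (rule open_Int_sets)
    then show ?thesis using that by (auto simp: N_def)
  qed
  moreover have "countable N" using B(1) by (simp add: N_def)
  ultimately have "(\<Union>U\<in>N. U \<inter> X) \<in> null_sets \<mu>"
    by (intro null_sets_UN') auto
  moreover have "{x \<in> space \<mu>. x \<notin> measure_support \<mu>} \<subseteq> (\<Union>U\<in>N. U \<inter> X)"
  proof
    fix x assume "x \<in> {x \<in> space \<mu>. x \<notin> measure_support \<mu>}"
    then obtain U where x: "x \<in> X" and U: "open U" "x \<in> U" "emeasure \<mu> (U \<inter> X) = 0"
      by (auto simp: measure_support_def)
    obtain V where V: "V \<in> B" "x \<in> V" "V \<subseteq> U"
      using topological_basisE[OF B(2) U(1,2)] by blast
    have "emeasure \<mu> (V \<inter> X) \<le> emeasure \<mu> (U \<inter> X)"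
      using V(3) U(1) by (intro emeasure_mono open_Int_sets) auto
    then have "V \<in> N" using V(1) U(3) by (simp add: N_def)
    then show "x \<in> (\<Union>U\<in>N. U \<inter> X)" using V(2) x by blast
  qed
  ultimately show ?thesis by (rule AE_I')
qed

end

section \<open>Mercer's theorem\<close>

text \<open>
  Indices start at 0. The assumption \<open>maximal\<close> encodes that \<open>L\<close> lists the positive eigenvalues with
  full multiplicity.
\<close>

locale eigensystem = mercer_space X K \<mu>
  for X :: "'a::euclidean_space set" and K and \<mu> +
  fixes L :: "nat \<Rightarrow> real" and u :: "nat \<Rightarrow> 'a \<Rightarrow> real"
  assumes L_nonneg: "0 \<le> L j"
    and u_cont: "continuous_on X (u j)"
    and u_eigen: "x \<in> X \<Longrightarrow> T (u j) x = L j * u j x"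
    and u_zero: "L j = 0 \<Longrightarrow> u j x = 0"
    and ortho: "ip (u i) (u j) = (if i = j \<and> 0 < L i then 1 else 0)"
    and maximal: "\<lbrakk>continuous_on X g; 0 < t; \<And>x. x \<in> X \<Longrightarrow> T g x = t * g x; ip g g = 1;
      \<And>j. j < m \<Longrightarrow> ip (u j) g = 0\<rbrakk> \<Longrightarrow> t \<le> L m"
begin

lemma coefficient:
  assumes "j < m"
  shows "ip (u j) (\<lambda>y. \<Sum>i<m. c i * u i y) = (if 0 < L j then c j else 0)"
proof -
  have "ip (u j) (\<lambda>y. \<Sum>i<m. c i * u i y) = (\<Sum>i<m. c i * (if j = i \<and> 0 < L j then 1 else 0))"
    by (subst ip_sum_right) (auto intro!: u_cont simp: ortho)
  also have "\<dots> = (\<Sum>i<m. if i = j then (if 0 < L j then c i else 0) else 0)"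
    by (intro sum.cong) auto
  also have "\<dots> = (if 0 < L j then c j else 0)"
    using assms by (simp add: sum.delta)
  finally show ?thesis .
qed

text \<open>If it failed, the constrained maximum of the form would be attained at an eigenfunction
  orthogonal to the first \<open>m\<close>, with an eigenvalue above \<open>L m\<close>;
  \<open>maximal\<close> forbids this.\<close>

lemma rayleigh_bound:
  assumes f: "continuous_on X f" and orth: "\<And>j. j < m \<Longrightarrow> ip (u j) f = 0"
  shows "ip (T f) f \<le> L m * ip f f"
proof (rule ccontr)
  assume "\<not> ?thesis"
  then have less: "L m * ip f f < ip (T f) f" by simp
  moreover have "0 \<le> L m * ip f f" using L_nonneg by simp
  ultimately have "0 < ip (T f) f" by linarith
  moreover have "f \<in> {f. continuous_on X f \<and> (\<forall>j\<in>{..<m}. ip (u j) f = 0)}" using f orth by simp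
  ultimately obtain g t where g: "g \<in> {f. continuous_on X f \<and> (\<forall>j\<in>{..<m}. ip (u j) f = 0)}"
    "ip g g = 1" "0 < t" "\<And>x. x \<in> X \<Longrightarrow> T g x = t * g x" and le: "ip (T f) f \<le> t * ip f f"
    using rayleigh_max[of "{..<m}" u L f thesis, OF u_cont u_eigen] by blast
  then have "t \<le> L m" by (intro maximal[of g]) auto
  then have "t * ip f f \<le> L m * ip f f" by (intro mult_right_mono) auto
  then show False using le less by simp
qed

text \<open>The test function \<open>h\<close> with coefficients \<open>u j x\<close> makes both
  \<open>T h x\<close> and the form of \<open>h\<close> equal to the partial sum \<open>s\<close>,
  so \<open>T_pointwise\<close> reads \<open>s\<^sup>2 \<le> K x x * s\<close>.\<close>

lemma bessel_diag:
  assumes x: "x \<in> X"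
  shows "(\<Sum>j<m. L j * (u j x)\<^sup>2) \<le> K x x"
proof -
  define h where "h y = (\<Sum>j<m. u j x * u j y)" for y
  have hc: "continuous_on X h"
    unfolding h_def by (intro continuous_intros u_cont)
  have Th: "T h y = (\<Sum>j<m. (u j x * L j) * u j y)" if "y \<in> X" for y
    unfolding h_def using that by (subst T_sum) (auto simp: u_eigen u_cont mult_ac)
  define s where "s = (\<Sum>j<m. L j * (u j x)\<^sup>2)"
  have 1: "T h x = s" using x by (simp add: Th s_def power2_eq_square mult_ac)
  have "ip (T h) h = ip h (\<lambda>y. \<Sum>j<m. (u j x * L j) * u j y)"
    using Th by (subst ip_commute) (auto intro!: ip_cong)
  also have "\<dots> = (\<Sum>j<m. (u j x * L j) * ip h (u j))"
    by (intro ip_sum_right u_cont hc)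
  also have "\<dots> = s"
    unfolding s_def
  proof (intro sum.cong refl)
    fix j assume "j \<in> {..<m}"
    then have "ip (u j) h = (if 0 < L j then u j x else 0)"
      using coefficient[of j m "\<lambda>i. u i x"] by (simp add: h_def[abs_def])
    then show "u j x * L j * ip h (u j) = L j * (u j x)\<^sup>2"
      using L_nonneg[of j] by (auto simp: power2_eq_square ip_commute[of h])
  qed
  finally have "s * s \<le> K x x * s"
    using T_pointwise[OF hc x] 1 by (simp add: power2_eq_square)
  moreover have "0 \<le> s" unfolding s_def by (intro sum_nonneg mult_nonneg_nonneg L_nonneg) auto
  ultimately have "s \<le> K x x"
    using K_diag_nonneg[OF x] by (cases "s = 0") (auto simp: mult_le_cancel_right)
  then show ?thesis by (simp add: s_def)
qed

lemma sum_L_eq: "(\<Sum>j<m. L j) = (\<integral>x. (\<Sum>j<m. L j * (u j x)\<^sup>2) \<partial>\<mu>)"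
proof -
  have "(\<integral>x. (\<Sum>j<m. L j * (u j x)\<^sup>2) \<partial>\<mu>) = (\<Sum>j<m. L j * ip (u j) (u j))"
    by (subst Bochner_Integration.integral_sum)
      (auto simp: ip_def power2_eq_square intro!: continuous_intros u_cont)
  also have "\<dots> = (\<Sum>j<m. L j)"
    using L_nonneg by (intro sum.cong) (auto simp: ortho less_le)
  finally show ?thesis by simp
qed

text \<open>The trace bounds the partial sums. The consequence that matters is that
  \<open>L m\<close> tends to 0.\<close>

lemma summable_L: "summable L"
proof (rule summableI_nonneg_bounded)
  show "(\<Sum>j<m. L j) \<le> (\<integral>x. K x x \<partial>\<mu>)" for m
    unfolding sum_L_eq
    by (intro integral_mono) (auto intro!: continuous_intros u_cont K_cont_diag bessel_diag)
qed (rule L_nonneg)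

text \<open>The remainder \<open>p m\<close> of \<open>f\<close> need not tend to 0, since
  \<open>T\<close> may have a kernel; its image does. By \<open>T_pointwise\<close> and
  \<open>rayleigh_bound\<close>, \<open>(T (p m) x)\<^sup>2\<close> is at most
  \<open>K x x * L m * ip f f\<close>.\<close>

lemma eigen_expansion:
  assumes f: "continuous_on X f" and x: "x \<in> X"
  shows "(\<lambda>j. ip (u j) f * (L j * u j x)) sums T f x"
proof -
  define S where "S m y = (\<Sum>j<m. ip (u j) f * u j y)" for m y
  define p where "p m y = f y + (-1) * S m y" for m y
  have Sc: "continuous_on X (S m)" for m
    unfolding S_def by (intro continuous_intros u_cont)
  have pc: "continuous_on X (p m)" for m
    unfolding p_def by (intro continuous_intros f Sc)
  have u0: "ip (u j) f = 0" if "\<not> 0 < L j" for j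
  proof -
    have "L j = 0" using that L_nonneg[of j] by simp
    then show ?thesis by (simp add: u_zero ip_def)
  qed
  have orth: "ip (u j) (p m) = 0" if "j < m" for j m
  proof -
    have "ip (u j) (S m) = ip (u j) f"
      using coefficient[OF that, of "\<lambda>j. ip (u j) f"] u0[of j] by (auto simp: S_def[abs_def])
    then show ?thesis
      unfolding p_def by (subst ip_add_right) (auto intro!: f Sc u_cont)
  qed
  have norm_le: "ip (p m) (p m) \<le> ip f f" for m
  proof -
    have "ip (p m) (S m) = (\<Sum>j<m. ip (u j) f * ip (p m) (u j))"
      unfolding S_def by (intro ip_sum_right u_cont pc)
    also have "\<dots> = 0"
      using orth by (intro sum.neutral) (auto simp: ip_commute[of "p m"])
    finally have "ip (\<lambda>x. p m x + 1 * S m x) (\<lambda>x. p m x + 1 * S m x) = ip (p m) (p m) + ip (S m) (S m)"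
      by (subst ip_add_self) (auto intro!: pc Sc)
    moreover have "(\<lambda>x. p m x + 1 * S m x) = f" by (simp add: p_def fun_eq_iff)
    ultimately show ?thesis using ip_nonneg[of "S m"] by simp
  qed
  have "(\<lambda>m. T (p m) x) \<longlonglongrightarrow> 0"
  proof (rule square_tendsto_zero, rule squeeze_zero)
    fix m
    have "(T (p m) x)\<^sup>2 \<le> K x x * ip (T (p m)) (p m)" by (intro T_pointwise pc x)
    also have "\<dots> \<le> K x x * (L m * ip (p m) (p m))"
      by (intro mult_left_mono rayleigh_bound pc orth K_diag_nonneg x)
    also have "\<dots> \<le> K x x * (L m * ip f f)"
      by (intro mult_left_mono norm_le K_diag_nonneg x L_nonneg)
    finally show "(T (p m) x)\<^sup>2 \<le> K x x * (L m * ip f f)" .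
    have "(\<lambda>m. K x x * (L m * ip f f)) \<longlonglongrightarrow> K x x * (0 * ip f f)"
      by (intro tendsto_intros summable_LIMSEQ_zero summable_L)
    then show "(\<lambda>m. K x x * (L m * ip f f)) \<longlonglongrightarrow> 0" by simp
  qed auto
  moreover have "T (p m) x = T f x - (\<Sum>j<m. ip (u j) f * (L j * u j x))" for m
  proof -
    have "T (p m) x = T f x + (-1) * T (S m) x"
      unfolding p_def by (intro T_add continuous_integrable f Sc x)
    also have "T (S m) x = (\<Sum>j<m. ip (u j) f * (L j * u j x))"
      unfolding S_def by (subst T_sum) (auto simp: x u_eigen u_cont)
    finally show ?thesis by simp
  qed
  ultimately have "(\<lambda>m. T f x - (\<Sum>j<m. ip (u j) f * (L j * u j x))) \<longlonglongrightarrow> 0" by simp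
  from tendsto_diff[OF tendsto_const[of "T f x"] this] show ?thesis
    by (simp add: sums_def)
qed

text \<open>
  For fixed \<open>x\<close> the series converges uniformly in \<open>y\<close> to a continuous function that has the same inner
  products as \<open>K x\<close> with all continuous functions.
\<close>

lemma mercer_sums:
  assumes x: "x \<in> X" and y: "y \<in> measure_support \<mu>"
  shows "(\<lambda>j. L j * u j x * u j y) sums K x y"
proof -
  obtain \<kappa> where \<kappa>: "0 \<le> \<kappa>" "\<And>x y. x \<in> X \<Longrightarrow> y \<in> X \<Longrightarrow> \<bar>K x y\<bar> \<le> \<kappa>"
    using K_bounded by blast
  have yX: "y \<in> X" using y by (auto simp: measure_support_def)
  define S where "S m z = (\<Sum>j<m. L j * u j x * u j z)" for m z
  have Sc: "continuous_on X (S m)" for m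
    unfolding S_def by (intro continuous_intros u_cont)
  have summable_diag: "summable (\<lambda>j. L j * (u j x)\<^sup>2)"
    by (rule summableI_nonneg_bounded[of _ "K x x"]) (auto simp: L_nonneg bessel_diag x)
  \<comment> \<open>Cauchy-Schwarz separates the variables: the factor in \<open>x\<close> is the
    tail of a convergent series, and the factor in \<open>z\<close> is bounded by
    \<open>\<kappa>\<close> uniformly.\<close>
  have tail: "(\<Sum>j=m..<n. L j * u j x * u j z)\<^sup>2 \<le> (\<Sum>j=m..<n. L j * (u j x)\<^sup>2) * \<kappa>" if "z \<in> X" for m n z
  proof -
    have "(\<Sum>j=m..<n. L j * u j x * u j z)\<^sup>2 = (\<Sum>j=m..<n. (sqrt (L j) * u j x) * (sqrt (L j) * u j z))\<^sup>2"
      by (intro arg_cong[where f = "\<lambda>s. s\<^sup>2"] sum.cong) (simp_all add: L_nonneg algebra_simps)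
    also have "\<dots> \<le> (\<Sum>j=m..<n. (sqrt (L j) * u j x)\<^sup>2) * (\<Sum>j=m..<n. (sqrt (L j) * u j z)\<^sup>2)"
      by (rule Cauchy_Schwarz_ineq_sum)
    also have "\<dots> = (\<Sum>j=m..<n. L j * (u j x)\<^sup>2) * (\<Sum>j=m..<n. L j * (u j z)\<^sup>2)"
      by (simp add: power_mult_distrib L_nonneg)
    also have "\<dots> \<le> (\<Sum>j=m..<n. L j * (u j x)\<^sup>2) * \<kappa>"
    proof (intro mult_left_mono sum_nonneg mult_nonneg_nonneg L_nonneg)
      have "(\<Sum>j=m..<n. L j * (u j z)\<^sup>2) \<le> (\<Sum>j<n. L j * (u j z)\<^sup>2)"
        by (intro sum_mono2) (auto simp: L_nonneg)
      also have "\<dots> \<le> \<kappa>" using bessel_diag[OF that, of n] \<kappa>(2)[OF that that] by simp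
      finally show "(\<Sum>j=m..<n. L j * (u j z)\<^sup>2) \<le> \<kappa>" .
    qed auto
    finally show ?thesis .
  qed
  have "uniformly_Cauchy_on X S"
  proof (rule uniformly_Cauchy_onI')
    fix e :: real assume e: "0 < e"
    then have "0 < e\<^sup>2 / (\<kappa> + 1)" using \<kappa>(1) by simp
    then obtain N where N: "\<And>m n. m \<ge> N \<Longrightarrow> norm (\<Sum>j=m..<n. L j * (u j x)\<^sup>2) < e\<^sup>2 / (\<kappa> + 1)"
      using summable_diag unfolding summable_Cauchy by metis
    show "\<exists>M. \<forall>z\<in>X. \<forall>m\<ge>M. \<forall>n>m. dist (S m z) (S n z) < e"
    proof (intro exI[of _ N] ballI allI impI)
      fix z m n assume z: "z \<in> X" and mn: "N \<le> m" "m < n"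
      have "S n z - S m z = (\<Sum>j=m..<n. L j * u j x * u j z)"
        using mn(2) unfolding S_def lessThan_atLeast0 by (intro sum_diff_nat_ivl) auto
      moreover have "(dist (S m z) (S n z))\<^sup>2 = (S n z - S m z)\<^sup>2"
        by (simp add: dist_real_def power2_commute)
      ultimately have "(dist (S m z) (S n z))\<^sup>2 = (\<Sum>j=m..<n. L j * u j x * u j z)\<^sup>2"
        by simp
      also have "\<dots> \<le> (\<Sum>j=m..<n. L j * (u j x)\<^sup>2) * \<kappa>" by (rule tail[OF z])
      also have "\<dots> \<le> e\<^sup>2 / (\<kappa> + 1) * \<kappa>"
        using N[OF mn(1), of n] \<kappa>(1) by (intro mult_right_mono) auto
      also have "\<dots> < e\<^sup>2" using \<kappa>(1) e by (simp add: field_simps)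
      finally show "dist (S m z) (S n z) < e"
        using e by (simp add: power2_less_imp_less)
    qed
  qed
  then obtain s where s: "uniform_limit X S s sequentially"
    using Cauchy_uniformly_convergent by (auto simp: uniformly_convergent_on_def)
  have sc: "continuous_on X s"
    by (rule uniform_limit_theorem[OF _ s]) (auto simp: Sc)
  \<comment> \<open>The difference is tested against itself: \<open>ip r s\<close> is the limit of
    \<open>ip r (S m)\<close>, hence equals \<open>T r x\<close>, which is
    \<open>ip r (K x)\<close>.\<close>
  define r where "r z = s z + (-1) * K x z" for z
  have rc: "continuous_on X r"
    unfolding r_def by (intro continuous_intros sc x)
  have S_lim: "(\<lambda>m. ip r (S m)) \<longlonglongrightarrow> ip r s"
  proof -
    have "(\<lambda>m. ip (\<lambda>z. S m z + (-1) * s z) (\<lambda>z. S m z + (-1) * s z)) \<longlonglongrightarrow> 0"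
      unfolding LIMSEQ_iff
    proof (intro allI impI)
      fix e :: real assume e: "0 < e"
      then have "\<forall>\<^sub>F m in sequentially. \<forall>z\<in>X. dist (S m z) (s z) < sqrt (e / 2)"
        using s by (auto simp: uniform_limit_iff)
      then obtain N where N: "\<And>m z. m \<ge> N \<Longrightarrow> z \<in> X \<Longrightarrow> \<bar>S m z - s z\<bar> < sqrt (e / 2)"
        by (auto simp: eventually_sequentially dist_real_def)
      have "ip (\<lambda>z. S m z + (-1) * s z) (\<lambda>z. S m z + (-1) * s z) \<le> (sqrt (e / 2))\<^sup>2" if "m \<ge> N" for m
        using N[OF that] by (intro ip_le_sup continuous_intros Sc sc) force
      then show "\<exists>N. \<forall>m\<ge>N. norm (ip (\<lambda>z. S m z + (-1) * s z) (\<lambda>z. S m z + (-1) * s z) - 0) < e"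
        using e by (intro exI[of _ N]) force
    qed
    then have 0: "(\<lambda>m. ip r r * ip (\<lambda>z. S m z + (-1) * s z) (\<lambda>z. S m z + (-1) * s z)) \<longlonglongrightarrow> 0"
      using tendsto_mult[OF tendsto_const, of _ 0 sequentially "ip r r"] by fastforce
    have "(\<lambda>m. ip r (\<lambda>z. S m z + (-1) * s z)) \<longlonglongrightarrow> 0"
      by (rule square_tendsto_zero, rule squeeze_zero[OF _ _ 0])
        (auto intro!: ip_cauchy_schwarz[of r "\<lambda>z. S _ z + (-1) * s z", simplified] rc continuous_intros Sc sc)
    moreover have "ip r (\<lambda>z. S m z + (-1) * s z) = ip r (S m) - ip r s" for m
      by (subst ip_add_right) (auto intro!: rc Sc sc)
    ultimately show ?thesis by (simp add: LIM_zero_iff)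
  qed
  have "(\<lambda>m. ip r (S m)) \<longlonglongrightarrow> T r x"
  proof -
    have "ip r (S m) = (\<Sum>j<m. ip (u j) r * (L j * u j x))" for m
      unfolding S_def by (subst ip_sum_right) (auto intro!: rc u_cont sum.cong simp: ip_commute[of r])
    then show ?thesis using eigen_expansion[OF rc x] by (simp add: sums_def)
  qed
  then have "ip r s = T r x" using LIMSEQ_unique S_lim by blast
  also have "T r x = ip r (K x)" by (simp add: kernel_op_def ip_def mult.commute)
  finally have "ip r r = 0"
    using ip_add_right[of s "K x" r "-1"] rc sc K_cont_right[OF x] by (simp add: r_def[abs_def])
  then have "r y = 0" using zero_on_support rc y by blast
  then have "s y = K x y" by (simp add: r_def)
  moreover have "(\<lambda>m. S m y) \<longlonglongrightarrow> s y"
    using tendsto_uniform_limitI[OF s yX] .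
  ultimately show ?thesis by (simp add: sums_def S_def)
qed

end

section \<open>Eigensystems from eigenvalue sequences\<close>

text \<open>The system is padded to a square matrix by zero rows. Row \<open>p\<close> is zero, so
  the transpose kills a unit vector and the determinant vanishes.\<close>

lemma underdetermined_system:
  fixes a :: "nat \<Rightarrow> nat \<Rightarrow> real"
  assumes "p < m"
  shows "\<exists>c. (\<exists>i<m. c i \<noteq> 0) \<and> (\<forall>k<p. (\<Sum>i<m. c i * a k i) = 0)"
proof -
  define A where "A = mat m m (\<lambda>(k, i). if k < p then a k i else 0)"
  have A: "A \<in> carrier_mat m m" by (simp add: A_def)
  have "transpose_mat A *\<^sub>v unit_vec m p = 0\<^sub>v m"
    using assms by (intro eq_vecI) (auto simp: A_def scalar_prod_right_unit)
  moreover have "unit_vec m p \<noteq> (0\<^sub>v m :: real Matrix.vec)"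
    using assms by (simp add: unit_vec_nonzero)
  ultimately have "det (transpose_mat A) = 0"
    using A by (subst det_0_iff_vec_prod_zero[of _ m]) (auto intro!: exI[of _ "unit_vec m p"])
  then have "det A = 0" using A by (simp add: det_transpose)
  then obtain v where v: "v \<in> carrier_vec m" "v \<noteq> 0\<^sub>v m" "A *\<^sub>v v = 0\<^sub>v m"
    using A det_0_iff_vec_prod_zero[of A m] by auto
  have "\<exists>i<m. vec_index v i \<noteq> 0"
    using v(1,2) by (metis carrier_vecD eq_vecI index_zero_vec(1,2))
  moreover have "(\<Sum>i<m. vec_index v i * a k i) = 0" if "k < p" for k
  proof -
    have "vec_index (A *\<^sub>v v) k = (\<Sum>i<m. vec_index v i * a k i)"
      using that assms v(1) by (auto simp: A_def scalar_prod_def lessThan_atLeast0 intro!: sum.cong)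
    then show ?thesis using v(3) that assms by simp
  qed
  ultimately show ?thesis by blast
qed

text \<open>A multiplicity is a supremum; attainment yields an actual independent family of that
  size. Nonemptiness matters because the supremum of the empty set is 0.\<close>

lemma Sup_enat_attained:
  assumes "Sup A = enat n" "A \<noteq> {}"
  shows "enat n \<in> A"
proof -
  have "finite A" "Max A = enat n"
    using assms by (auto simp: Sup_enat_def split: if_splits)
  then show ?thesis using Max_in[of A] assms(2) by simp
qed

lemma eigenvalue_seq_antimono: "eigenvalue_seq K \<mu> l \<Longrightarrow> 1 \<le> i \<Longrightarrow> i \<le> j \<Longrightarrow> l j \<le> l i"
  by (auto simp: eigenvalue_seq_def monotone_on_def)

section \<open>Orthonormal families of eigenfunctions\<close>

context mercer_space
begin

lemma orthonormal_sum_zero: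
  fixes F :: "nat \<Rightarrow> 'a \<Rightarrow> real"
  assumes F: "\<And>i. i < n \<Longrightarrow> continuous_on X (F i)"
    and on: "\<And>i j. i < n \<Longrightarrow> j < n \<Longrightarrow> ip (F i) (F j) = (if i = j then 1 else 0)"
    and AE0: "AE x in \<mu>. (\<Sum>i<n. c i * F i x) = 0" and k: "k < n"
  shows "c k = 0"
proof -
  have "ip (F k) (\<lambda>x. \<Sum>i<n. c i * F i x) = 0"
    unfolding ip_def using AE0 by (intro integral_eq_zero_AE) auto
  moreover have "ip (F k) (\<lambda>x. \<Sum>i<n. c i * F i x) = (\<Sum>i<n. c i * (if k = i then 1 else 0))"
    using F on k by (subst ip_sum_right) auto
  ultimately show ?thesis using k by (simp add: if_distrib[of "(*) _"] cong: if_cong)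
qed

text \<open>Gram-Schmidt as a dimension count: \<open>p\<close> conditions on \<open>m > p\<close>
  coefficients leave a nonzero combination. The \<open>e k\<close> need not lie in the span of the
  \<open>f i\<close>.\<close>

lemma orthonormal_step:
  fixes f e :: "nat \<Rightarrow> 'a \<Rightarrow> real"
  assumes f: "\<And>i. i < m \<Longrightarrow> continuous_on X (f i)"
    and indep: "\<And>c. ip (\<lambda>x. \<Sum>i<m. c i * f i x) (\<lambda>x. \<Sum>i<m. c i * f i x) = 0 \<Longrightarrow> \<forall>i<m. c i = 0"
    and e: "\<And>k. k < p \<Longrightarrow> continuous_on X (e k)" and "p < m"
  obtains c where "ip (\<lambda>x. \<Sum>i<m. c i * f i x) (\<lambda>x. \<Sum>i<m. c i * f i x) = 1"
    "\<And>k. k < p \<Longrightarrow> ip (e k) (\<lambda>x. \<Sum>i<m. c i * f i x) = 0"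
proof -
  have "\<exists>c. (\<exists>i<m. c i \<noteq> 0) \<and> (\<forall>k<p. (\<Sum>i<m. c i * ip (e k) (f i)) = 0)"
    by (rule underdetermined_system[OF \<open>p < m\<close>])
  then obtain c where "(\<exists>i<m. c i \<noteq> 0) \<and> (\<forall>k<p. (\<Sum>i<m. c i * ip (e k) (f i)) = 0)" ..
  then have c: "\<exists>i<m. c i \<noteq> 0" "\<And>k. k < p \<Longrightarrow> (\<Sum>i<m. c i * ip (e k) (f i)) = 0"
    by blast+
  define g where "g = (\<lambda>x. \<Sum>i<m. c i * f i x)"
  have "ip g g \<noteq> 0"
  proof
    assume "ip g g = 0"
    then have "\<forall>i<m. c i = 0" unfolding g_def by (rule indep)
    then show False using c(1) by blast
  qed
  then have pos: "0 < ip g g" using ip_nonneg[of g] by linarith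
  define s where "s = 1 / sqrt (ip g g)"
  have eq: "(\<lambda>x. \<Sum>i<m. (s * c i) * f i x) = (\<lambda>x. s * g x)"
    by (simp add: g_def sum_distrib_left mult_ac)
  have "ip (\<lambda>x. s * g x) (\<lambda>x. s * g x) = 1"
    unfolding ip_cmult using pos by (simp add: s_def field_simps)
  moreover have "ip (e k) (\<lambda>x. s * g x) = 0" if "k < p" for k
    unfolding ip_cmult g_def using c(2)[OF that] f e[OF that] by (subst ip_sum_right) auto
  ultimately show thesis using that[of "\<lambda>i. s * c i"] unfolding eq by blast
qed

definition eigenfunctions :: "real \<Rightarrow> ('a \<Rightarrow> real) set"
  where "eigenfunctions t = {f. continuous_on X f \<and> (\<forall>x\<in>X. T f x = t * f x)}"

lemma eigenfunctions_sum:
  assumes "\<And>i. i < m \<Longrightarrow> f i \<in> eigenfunctions t"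
  shows "(\<lambda>x. \<Sum>i<m. c i * f i x) \<in> eigenfunctions t"
proof -
  have "T (\<lambda>x. \<Sum>i<m. c i * f i x) x = t * (\<Sum>i<m. c i * f i x)" if "x \<in> X" for x
    using assms that
    by (subst T_sum) (auto simp: eigenfunctions_def sum_distrib_left mult_ac)
  moreover have "continuous_on X (\<lambda>x. \<Sum>i<m. c i * f i x)"
    using assms by (intro continuous_intros) (auto simp: eigenfunctions_def)
  ultimately show ?thesis by (simp add: eigenfunctions_def)
qed

lemma eigenfunctions_eigenspace:
  assumes "f \<in> eigenfunctions t"
  shows "f \<in> eigenspace K \<mu> t"
  using assms
  by (auto simp: eigenfunctions_def eigenspace_def L2_def intro!: continuous_measurable continuous_integrable continuous_intros)

lemma orthonormal_eigenfunctions: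
  fixes f :: "nat \<Rightarrow> 'a \<Rightarrow> real"
  assumes f: "\<And>i. i < m \<Longrightarrow> f i \<in> eigenfunctions t"
    and indep: "\<And>c. ip (\<lambda>x. \<Sum>i<m. c i * f i x) (\<lambda>x. \<Sum>i<m. c i * f i x) = 0 \<Longrightarrow> \<forall>i<m. c i = 0"
    and "p \<le> m"
  shows "\<exists>e. \<forall>i<p. e i \<in> eigenfunctions t \<and> (\<forall>j<p. ip (e i) (e j) = (if i = j then 1 else 0))"
  using \<open>p \<le> m\<close>
proof (induction p)
  case (Suc p)
  then obtain e where e: "\<And>i. i < p \<Longrightarrow> e i \<in> eigenfunctions t"
    "\<And>i j. i < p \<Longrightarrow> j < p \<Longrightarrow> ip (e i) (e j) = (if i = j then 1 else 0)"
    by auto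
  obtain c where c: "ip (\<lambda>x. \<Sum>i<m. c i * f i x) (\<lambda>x. \<Sum>i<m. c i * f i x) = 1"
    "\<And>k. k < p \<Longrightarrow> ip (e k) (\<lambda>x. \<Sum>i<m. c i * f i x) = 0"
    using orthonormal_step[of m f p e thesis] Suc.prems f e indep by (auto simp: eigenfunctions_def)
  define g where "g = (\<lambda>x. \<Sum>i<m. c i * f i x)"
  have "g \<in> eigenfunctions t" unfolding g_def by (intro eigenfunctions_sum f)
  moreover have "ip g g = 1" "\<And>k. k < p \<Longrightarrow> ip (e k) g = 0" "\<And>k. k < p \<Longrightarrow> ip g (e k) = 0"
    using c by (simp_all add: g_def ip_commute[of _ "e _"])
  ultimately show ?case
    using e by (intro exI[of _ "e(p := g)"]) (auto simp: less_Suc_eq)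
qed simp

text \<open>\<open>T f / t\<close> is continuous and agrees with \<open>f\<close> almost everywhere;
  as \<open>T\<close> does not see null sets, it satisfies the eigenvalue equation at every
  point.\<close>

lemma eigenspace_continuous_version:
  assumes "f \<in> eigenspace K \<mu> t" "0 < t"
  obtains f' where "f' \<in> eigenfunctions t" "AE x in \<mu>. f' x = f x"
proof -
  have fm: "f \<in> borel_measurable \<mu>" and sq: "integrable \<mu> (\<lambda>x. (f x)\<^sup>2)" and ae: "AE x in \<mu>. T f x = t * f x"
    using assms(1) by (auto simp: eigenspace_def L2_def)
  have int: "integrable \<mu> f"
    by (rule square_integrable_imp_integrable[OF fm sq])
  define f' where "f' x = T f x / t" for x
  have c: "continuous_on X f'"
    unfolding f'_def using assms(2) by (intro continuous_intros T_cont int) auto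
  have ae': "AE x in \<mu>. f' x = f x"
    using ae assms(2) by (auto simp: f'_def elim!: eventually_mono)
  have "T f' x = t * f' x" if "x \<in> X" for x
  proof -
    have "t * f' x = T f x" using assms(2) by (simp add: f'_def)
    then show ?thesis using T_cong_AE[OF continuous_measurable[OF c] fm ae' that] by simp
  qed
  then show thesis using c ae' by (intro that[of f']) (auto simp: eigenfunctions_def)
qed

text \<open>The shift by \<open>Suc\<close> passes from sequences starting at 1 to indices starting
  at 0, and entries with eigenvalue 0 receive the zero function. For maximality suppose
  \<open>t > l (Suc m)\<close>: all entries equal to \<open>t\<close> then come before position
  \<open>Suc m\<close>, so \<open>g\<close> is orthogonal to their eigenfunctions, and adding it to
  them exceeds the multiplicity of \<open>t\<close>.\<close>

lemma eigensystemI: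
  assumes l: "eigenvalue_seq K \<mu> l"
    and \<psi>: "\<And>j. 1 \<le> j \<Longrightarrow> 0 < l j \<Longrightarrow> \<psi> j \<in> eigenfunctions (l j)"
    and on: "\<And>i j. 1 \<le> i \<Longrightarrow> 1 \<le> j \<Longrightarrow> 0 < l i \<Longrightarrow> 0 < l j \<Longrightarrow>
      ip (\<psi> i) (\<psi> j) = (if i = j then 1 else 0)"
  shows "eigensystem X K \<mu> (\<lambda>j. l (Suc j)) (\<lambda>j x. if 0 < l (Suc j) then \<psi> (Suc j) x else 0)"
    (is "eigensystem X K \<mu> _ ?u")
proof (unfold_locales)
  have nonneg: "0 \<le> l (Suc j)" for j using l by (simp add: eigenvalue_seq_def)
  show "0 \<le> l (Suc j)" for j by (rule nonneg)
  show "continuous_on X (?u j)" for j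
    using \<psi>[of "Suc j"] by (cases "0 < l (Suc j)") (auto simp: eigenfunctions_def)
  show "T (?u j) x = l (Suc j) * ?u j x" if "x \<in> X" for x j
    using \<psi>[of "Suc j"] that by (auto simp: eigenfunctions_def kernel_op_def)
  show "?u j x = 0" if "l (Suc j) = 0" for j x using that by simp
  show "ip (?u i) (?u j) = (if i = j \<and> 0 < l (Suc i) then 1 else 0)" for i j
    using on[of "Suc i" "Suc j"]
    by (cases "0 < l (Suc i)"; cases "0 < l (Suc j)") (auto simp: ip_def)
  fix g t m
  assume g: "continuous_on X g" "0 < t" "\<And>x. x \<in> X \<Longrightarrow> T g x = t * g x" "ip g g = 1"
    and orth: "\<And>j. j < m \<Longrightarrow> ip (?u j) g = 0"
  show "t \<le> l (Suc m)"
  proof (rule ccontr)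
    assume "\<not> ?thesis"
    then have less: "l (Suc m) < t" by simp
    define J where "J = {j. 1 \<le> j \<and> l j = t}"
    define n where "n = card J"
    have fin: "finite J" and mult: "eigen_multiplicity K \<mu> t = enat n"
      using l g(2) by (auto simp: eigenvalue_seq_def J_def n_def)
    obtain h where h: "bij_betw h {0..<n} J"
      using ex_bij_betw_nat_finite[OF fin] by (auto simp: n_def)
    have hJ: "1 \<le> h i" "l (h i) = t" if "i < n" for i
      using bij_betwE[OF h] that by (auto simp: J_def)
    have orth': "ip (\<psi> (h i)) g = 0" if "i < n" for i
    proof -
      have "h i - 1 < m"
      proof (rule ccontr)
        assume "\<not> h i - 1 < m"
        then have "Suc m \<le> h i" using hJ[OF that] by simp
        then show False using eigenvalue_seq_antimono[OF l, of "Suc m" "h i"] hJ[OF that] less by simp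
      qed
      then show ?thesis using orth[of "h i - 1"] hJ[OF that] g(2) by simp
    qed
    define F where "F i = (if i < n then \<psi> (h i) else g)" for i
    have F_E: "F i \<in> eigenfunctions t" for i
      using \<psi>[of "h i"] hJ[of i] g by (auto simp: F_def eigenfunctions_def)
    have F_on: "ip (F i) (F j) = (if i = j then 1 else 0)" if "i < Suc n" "j < Suc n" for i j
    proof -
      have "h i = h j \<longleftrightarrow> i = j" if "i < n" "j < n"
        using h that by (auto simp: bij_betw_def inj_on_def)
      then show ?thesis
        using that on[of "h i" "h j"] hJ orth' g(2,4) ip_commute[of g "\<psi> _"]
        by (auto simp: F_def less_Suc_eq)
    qed
    have "enat (Suc n) \<le> eigen_multiplicity K \<mu> t"
      unfolding eigen_multiplicity_def
    proof (intro Sup_upper CollectI exI conjI allI impI)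
      show "F i \<in> eigenspace K \<mu> t" for i by (intro eigenfunctions_eigenspace F_E)
      fix c k assume "AE x in \<mu>. (\<Sum>i<Suc n. c i * F i x) = 0" "k < Suc n"
      then show "c k = 0"
        using orthonormal_sum_zero[of "Suc n" F c k] F_E F_on by (auto simp: eigenfunctions_def)
    qed simp
    then show False using mult by simp
  qed
qed

text \<open>A positive level with \<open>n\<close> entries has \<open>n\<close> independent
  eigenfunctions, which are made continuous and orthonormal. Between distinct levels orthogonality
  follows from self-adjointness.\<close>

lemma eigensystem_exists:
  assumes l: "eigenvalue_seq K \<mu> l"
  obtains \<psi> where "eigensystem X K \<mu> (\<lambda>j. l (Suc j)) \<psi>"
proof -
  define J where "J t = {j. 1 \<le> j \<and> l j = t}" for t
  have "\<exists>e. \<forall>j\<in>J t. e j \<in> eigenfunctions t \<and> (\<forall>i\<in>J t. ip (e i) (e j) = (if i = j then 1 else 0))"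
    if t: "0 < t" for t
  proof -
    define n where "n = card (J t)"
    have fin: "finite (J t)" and mult: "eigen_multiplicity K \<mu> t = enat n"
      using l t by (auto simp: eigenvalue_seq_def J_def n_def)
    have "enat n \<in> {enat m |m. \<exists>f. (\<forall>i<m. f i \<in> eigenspace K \<mu> t) \<and>
       (\<forall>c. (AE x in \<mu>. (\<Sum>i<m. c i * f i x) = 0) \<longrightarrow> (\<forall>i<m. c i = 0))}" (is "_ \<in> ?A")
    proof (rule Sup_enat_attained)
      show "Sup ?A = enat n" using mult unfolding eigen_multiplicity_def .
      have "enat 0 \<in> ?A" by auto
      then show "?A \<noteq> {}" by blast
    qed
    then obtain f where f: "\<And>i. i < n \<Longrightarrow> f i \<in> eigenspace K \<mu> t"
      and indep: "\<And>c. (AE x in \<mu>. (\<Sum>i<n. c i * f i x) = 0) \<Longrightarrow> \<forall>i<n. c i = 0"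
      by auto
    have "\<exists>g. g \<in> eigenfunctions t \<and> (AE x in \<mu>. g x = f i x)" if "i < n" for i
      by (rule eigenspace_continuous_version[OF f[OF that] t]) blast
    then have "\<exists>f'. \<forall>i<n. f' i \<in> eigenfunctions t \<and> (AE x in \<mu>. f' i x = f i x)"
      by metis
    then obtain f' where f': "\<And>i. i < n \<Longrightarrow> f' i \<in> eigenfunctions t"
      "\<And>i. i < n \<Longrightarrow> AE x in \<mu>. f' i x = f i x" by blast
    have all: "AE x in \<mu>. \<forall>i\<in>{..<n}. f' i x = f i x"
      using f'(2) by (intro AE_finite_allI) auto
    have "\<forall>i<n. c i = 0"
      if "ip (\<lambda>x. \<Sum>i<n. c i * f' i x) (\<lambda>x. \<Sum>i<n. c i * f' i x) = 0" for c
    proof (rule indep)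
      have "integrable \<mu> (\<lambda>x. (\<Sum>i<n. c i * f' i x) * (\<Sum>i<n. c i * f' i x))"
        using f'(1) by (intro continuous_integrable continuous_intros) (auto simp: eigenfunctions_def)
      then have "AE x in \<mu>. (\<Sum>i<n. c i * f' i x) * (\<Sum>i<n. c i * f' i x) = 0"
        using that by (subst (asm) ip_def, subst (asm) integral_nonneg_eq_0_iff_AE) auto
      with all show "AE x in \<mu>. (\<Sum>i<n. c i * f i x) = 0"
        by eventually_elim simp
    qed
    then have "\<exists>e. \<forall>i<n. e i \<in> eigenfunctions t \<and> (\<forall>j<n. ip (e i) (e j) = (if i = j then 1 else 0))"
      using f'(1) by (intro orthonormal_eigenfunctions[of n f' t n]) auto
    then obtain e where e: "\<And>i. i < n \<Longrightarrow> e i \<in> eigenfunctions t"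
      "\<And>i j. i < n \<Longrightarrow> j < n \<Longrightarrow> ip (e i) (e j) = (if i = j then 1 else 0)"
      by metis
    obtain h where h: "bij_betw h (J t) {0..<n}"
      using ex_bij_betw_finite_nat[OF fin] by (auto simp: n_def)
    have hn: "h j < n" if "j \<in> J t" for j using bij_betwE[OF h] that by auto
    have "h i = h j \<longleftrightarrow> i = j" if "i \<in> J t" "j \<in> J t" for i j
      using h that by (auto simp: bij_betw_def inj_on_def)
    then show ?thesis
      using e hn by (intro exI[of _ "\<lambda>j. e (h j)"]) auto
  qed
  then obtain \<Psi> where \<Psi>: "\<And>t j. 0 < t \<Longrightarrow> j \<in> J t \<Longrightarrow> \<Psi> t j \<in> eigenfunctions t"
    "\<And>t i j. 0 < t \<Longrightarrow> i \<in> J t \<Longrightarrow> j \<in> J t \<Longrightarrow> ip (\<Psi> t i) (\<Psi> t j) = (if i = j then 1 else 0)"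
    by metis
  define \<psi> where "\<psi> j = \<Psi> (l j) j" for j
  have \<psi>: "\<psi> j \<in> eigenfunctions (l j)" if "1 \<le> j" "0 < l j" for j
    using \<Psi>(1)[of "l j" j] that by (auto simp: \<psi>_def J_def)
  have "ip (\<psi> i) (\<psi> j) = (if i = j then 1 else 0)"
    if ij: "1 \<le> i" "1 \<le> j" "0 < l i" "0 < l j" for i j
  proof (cases "l i = l j")
    case True
    then show ?thesis using \<Psi>(2)[of "l j" i j] ij by (auto simp: \<psi>_def J_def)
  next
    case False
    have "l i * ip (\<psi> i) (\<psi> j) = ip (\<lambda>x. l i * \<psi> i x) (\<psi> j)" by simp
    also have "\<dots> = ip (T (\<psi> i)) (\<psi> j)"
      using \<psi>[OF ij(1,3)] by (intro ip_cong) (auto simp: eigenfunctions_def)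
    also have "\<dots> = ip (\<psi> i) (T (\<psi> j))"
      using \<psi> ij by (intro T_selfadjoint) (auto simp: eigenfunctions_def)
    also have "\<dots> = ip (\<psi> i) (\<lambda>x. l j * \<psi> j x)"
      using \<psi>[OF ij(2,4)] by (intro ip_cong) (auto simp: eigenfunctions_def)
    also have "\<dots> = l j * ip (\<psi> i) (\<psi> j)" by simp
    finally show ?thesis using False by auto
  qed
  then show thesis using that eigensystemI[OF l \<psi>] by blast
qed

end

section \<open>The remainder kernel\<close>

context eigensystem
begin

text \<open>By Mercer's expansion the form of the remainder is the tail of a series of weighted
  squares, the \<open>a p\<close>. The points must lie in the support for the expansion to
  hold.\<close>

lemma remainder_psd:
  fixes n :: nat
  assumes x: "\<And>i. i < n \<Longrightarrow> x i \<in> measure_support \<mu>"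
  shows "0 \<le> (\<Sum>i<n. \<Sum>j<n. c i * c j * (K (x i) (x j) - (\<Sum>p<m. L p * u p (x i) * u p (x j))))"
proof -
  have xX: "x i \<in> X" if "i < n" for i using x[OF that] by (auto simp: measure_support_def)
  define a where "a p = L p * (\<Sum>i<n. c i * u p (x i))\<^sup>2" for p
  have a_eq: "a p = (\<Sum>i<n. \<Sum>j<n. c i * c j * (L p * u p (x i) * u p (x j)))" for p
    by (simp add: a_def power2_eq_square sum_product sum_distrib_left mult_ac)
  have "a sums (\<Sum>i<n. \<Sum>j<n. c i * c j * K (x i) (x j))"
    unfolding a_eq[abs_def] using x xX by (intro sums_sum sums_mult mercer_sums) auto
  then have "summable a" and "suminf a = (\<Sum>i<n. \<Sum>j<n. c i * c j * K (x i) (x j))"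
    by (simp_all add: sums_iff)
  moreover from \<open>summable a\<close> have "(\<Sum>p<m. a p) \<le> suminf a"
    by (rule sum_le_suminf) (simp_all add: a_def L_nonneg)
  moreover have "(\<Sum>p<m. a p) = (\<Sum>i<n. \<Sum>j<n. c i * c j * (\<Sum>p<m. L p * u p (x i) * u p (x j)))"
  proof -
    let ?t = "\<lambda>i j p. c i * c j * (L p * u p (x i) * u p (x j))"
    have "(\<Sum>p<m. a p) = (\<Sum>i<n. \<Sum>p<m. \<Sum>j<n. ?t i j p)"
      unfolding a_eq by (rule sum.swap)
    also have "\<dots> = (\<Sum>i<n. \<Sum>j<n. \<Sum>p<m. ?t i j p)"
      by (intro sum.cong refl sum.swap)
    finally show ?thesis by (simp only: sum_distrib_left)
  qed
  ultimately show ?thesis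
    by (simp add: right_diff_distrib sum_subtractf)
qed

lemma remainder_diag_cont: "continuous_on X (\<lambda>x. K x x - (\<Sum>p<m. L p * (u p x)\<^sup>2))"
  by (intro continuous_intros K_cont_diag u_cont)

text \<open>The expansion on the diagonal, integrated term by term; nonnegativity justifies the
  exchange. A second measure is allowed because the expansion for \<open>P\<close> is integrated
  against \<open>\<rho>\<close>; in the Gram estimate both measures are
  \<open>\<rho>\<close>.\<close>

lemma remainder_trace:
  assumes "mercer_space X K \<nu>" and supp: "AE x in \<nu>. x \<in> measure_support \<mu>"
  shows "ennreal (\<integral>x. K x x - (\<Sum>p<m. L p * (u p x)\<^sup>2) \<partial>\<nu>)
    = (\<Sum>p. ennreal (L (m + p) * (\<integral>x. (u (m + p) x)\<^sup>2 \<partial>\<nu>)))"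
proof -
  interpret N: mercer_space X K \<nu> by fact
  have int: "integrable \<nu> (\<lambda>x. (u p x)\<^sup>2)" for p
    by (intro N.continuous_integrable continuous_intros u_cont)
  have tail: "ennreal (K x x - (\<Sum>p<m. L p * (u p x)\<^sup>2)) = (\<Sum>p. ennreal (L (m + p) * (u (m + p) x)\<^sup>2))"
    if x: "x \<in> measure_support \<mu>" for x
  proof -
    have "x \<in> X" using x by (auto simp: measure_support_def)
    then have "(\<lambda>p. L (p + m) * u (p + m) x * u (p + m) x) sums (K x x - (\<Sum>p<m. L p * u p x * u p x))"
      by (intro sums_split_initial_segment mercer_sums x)
    then have 1: "(\<lambda>p. L (m + p) * (u (m + p) x)\<^sup>2) sums (K x x - (\<Sum>p<m. L p * (u p x)\<^sup>2))"
      by (simp only: power2_eq_square mult.assoc add.commute[of _ m])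
    have "(\<Sum>p. ennreal (L (m + p) * (u (m + p) x)\<^sup>2)) = ennreal (\<Sum>p. L (m + p) * (u (m + p) x)\<^sup>2)"
      by (rule suminf_ennreal2[OF _ sums_summable[OF 1]]) (simp add: L_nonneg)
    then show ?thesis by (simp only: sums_unique[OF 1])
  qed
  have "ennreal (\<integral>x. K x x - (\<Sum>p<m. L p * (u p x)\<^sup>2) \<partial>\<nu>)
      = (\<integral>\<^sup>+x. ennreal (K x x - (\<Sum>p<m. L p * (u p x)\<^sup>2)) \<partial>\<nu>)"
    by (intro nn_integral_eq_integral[symmetric] N.continuous_integrable remainder_diag_cont AE_I2)
      (simp add: bessel_diag)
  also have "\<dots> = (\<integral>\<^sup>+x. (\<Sum>p. ennreal (L (m + p) * (u (m + p) x)\<^sup>2)) \<partial>\<nu>)"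
    using supp by (intro nn_integral_cong_AE) (auto simp: tail elim!: eventually_mono)
  also have "\<dots> = (\<Sum>p. \<integral>\<^sup>+x. ennreal (L (m + p) * (u (m + p) x)\<^sup>2) \<partial>\<nu>)"
    using int by (intro nn_integral_suminf) (auto intro!: borel_measurable_times dest: borel_measurable_integrable)
  also have "\<dots> = (\<Sum>p. ennreal (L (m + p) * (\<integral>x. (u (m + p) x)\<^sup>2 \<partial>\<nu>)))"
    using int L_nonneg by (intro suminf_cong) (subst nn_integral_eq_integral, auto)
  finally show ?thesis .
qed

text \<open>
  Some nonzero combination \<open>f\<close> of the first \<open>m + 1\<close> eigenfunctions for \<open>\<nu>\<close> is orthogonal in \<open>L\<^sup>2(\<nu>)\<close> to
  \<open>u 0, \<dots>, u (m - 1)\<close>, so that only the remainder kernel acts on it; the form of a positive kernel is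
  bounded by its trace.
\<close>

lemma eigenvalue_le_trace:
  assumes "eigensystem X K \<nu> L' w" and supp: "X \<subseteq> measure_support \<mu>"
    and decr: "\<And>i. i \<le> m \<Longrightarrow> L' m \<le> L' i"
  shows "L' m \<le> (\<integral>x. K x x - (\<Sum>p<m. L p * (u p x)\<^sup>2) \<partial>\<nu>)"
proof -
  interpret N: eigensystem X K \<nu> L' w by fact
  define Q where "Q x y = K x y - (\<Sum>p<m. L p * u p x * u p y)" for x y
  define \<tau> where "\<tau> = (\<integral>x. Q x x \<partial>\<nu>)"
  have Q_diag: "Q x x = K x x - (\<Sum>p<m. L p * (u p x)\<^sup>2)" for x
    by (simp add: Q_def power2_eq_square mult.assoc)
  have Qc: "continuous_on X (\<lambda>x. Q x x)"
    unfolding Q_diag by (rule remainder_diag_cont)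
  have \<tau>_nonneg: "0 \<le> \<tau>"
    unfolding \<tau>_def Q_diag by (intro Bochner_Integration.integral_nonneg) (simp add: bessel_diag)
  show ?thesis
  proof (cases "0 < L' m")
    case False
    then show ?thesis using \<tau>_nonneg unfolding \<tau>_def Q_diag by simp
  next
    case True
    \<comment> \<open>\<open>coefficient\<close> returns \<open>c i\<close> only for entries with
      positive eigenvalue.\<close>
    have pos: "0 < L' i" if "i < Suc m" for i using decr[of i] True that by simp
    have "\<exists>c. (\<exists>i<Suc m. c i \<noteq> 0) \<and> (\<forall>k<m. (\<Sum>i<Suc m. c i * N.ip (u k) (w i)) = 0)"
      by (rule underdetermined_system) simp
    then obtain c where c1: "\<exists>i<Suc m. c i \<noteq> 0"
      and c2: "\<forall>k<m. (\<Sum>i<Suc m. c i * N.ip (u k) (w i)) = 0"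
      by blast
    define f where "f x = (\<Sum>i<Suc m. c i * w i x)" for x
    define s where "s = (\<Sum>i<Suc m. (c i)\<^sup>2)"
    have fc: "continuous_on X f"
      unfolding f_def by (intro continuous_intros N.u_cont)
    have orth: "N.ip (u k) f = 0" if "k < m" for k
      using c2 that N.u_cont u_cont
      by (simp add: f_def[abs_def] N.ip_sum_right del: sum.lessThan_Suc)
    have coeff: "N.ip f (w i) = c i" if "i < Suc m" for i
      using N.coefficient[OF that, of c] pos[OF that]
      by (simp add: f_def[abs_def] N.ip_commute[of _ "w i"] del: sum.lessThan_Suc)
    have ff: "N.ip f f = s"
    proof -
      have "N.ip f f = (\<Sum>i<Suc m. c i * N.ip f (w i))"
        by (subst (2) f_def[abs_def], intro N.ip_sum_right N.u_cont fc)
      also have "\<dots> = s"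
        unfolding s_def by (intro sum.cong) (auto simp: coeff power2_eq_square)
      finally show ?thesis .
    qed
    have Tff: "N.ip (N.T f) f = (\<Sum>i<Suc m. L' i * (c i)\<^sup>2)"
    proof -
      have "N.T f x = (\<Sum>i<Suc m. (c i * L' i) * w i x)" if "x \<in> X" for x
        unfolding f_def using that
        by (subst N.T_sum) (auto simp: N.u_eigen N.u_cont mult_ac)
      then have "N.ip (N.T f) f = N.ip f (\<lambda>x. \<Sum>i<Suc m. (c i * L' i) * w i x)"
        by (subst N.ip_commute, intro N.ip_cong refl) auto
      also have "\<dots> = (\<Sum>i<Suc m. (c i * L' i) * N.ip f (w i))"
        by (intro N.ip_sum_right N.u_cont fc)
      also have "\<dots> = (\<Sum>i<Suc m. L' i * (c i)\<^sup>2)"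
        by (intro sum.cong) (auto simp: coeff power2_eq_square)
      finally show ?thesis .
    qed
    have Qf: "(\<integral>y. Q x y * f y \<partial>\<nu>) = N.T f x" "integrable \<nu> (\<lambda>y. Q x y * f y)" if x: "x \<in> X" for x
    proof -
      have uf: "integrable \<nu> (\<lambda>y. u p y * f y)" for p
        by (intro N.continuous_integrable continuous_intros u_cont fc)
      have Kf: "integrable \<nu> (\<lambda>y. K x y * f y)"
        by (intro N.K_integrable N.continuous_integrable fc x)
      have eq: "Q x y * f y = K x y * f y - (\<Sum>p<m. (L p * u p x) * (u p y * f y))" for y
        by (simp add: Q_def algebra_simps sum_distrib_left)
      show "integrable \<nu> (\<lambda>y. Q x y * f y)"
        unfolding eq using uf Kf by (intro Bochner_Integration.integrable_diff Bochner_Integration.integrable_sum) auto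
      have "(\<integral>y. Q x y * f y \<partial>\<nu>) = N.T f x - (\<Sum>p<m. (L p * u p x) * N.ip (u p) f)"
        unfolding eq using uf Kf
        by (subst Bochner_Integration.integral_diff)
          (auto simp: kernel_op_def N.ip_def Bochner_Integration.integral_sum)
      then show "(\<integral>y. Q x y * f y \<partial>\<nu>) = N.T f x" by (simp add: orth)
    qed
    have Qff: "integrable \<nu> (\<lambda>y. (f y)\<^sup>2)" "(\<integral>y. (f y)\<^sup>2 \<partial>\<nu>) = s"
      using ff fc by (auto simp: N.ip_def power2_eq_square intro!: N.continuous_integrable continuous_intros)
    have Qint: "integrable \<nu> (\<lambda>x. Q x x)"
      by (intro N.continuous_integrable Qc)
    \<comment> \<open>Positivity of \<open>Q\<close> at the two points \<open>x\<close>,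
      \<open>y\<close> with weights \<open>f y\<close> and \<open>- f x\<close>. Integration over
      both variables gives \<open>0 \<le> 2 * s * \<tau> - 2 * N.ip (N.T f) f\<close>, the bound of
      the form by the trace.\<close>
    have pt: "0 \<le> (f y)\<^sup>2 * Q x x - 2 * f x * (Q x y * f y) + (f x)\<^sup>2 * Q y y"
      if "x \<in> X" "y \<in> X" for x y
    proof -
      have "0 \<le> (\<Sum>i<2::nat. \<Sum>j<2::nat. (if i = 0 then f y else - f x) * (if j = 0 then f y else - f x)
          * Q (if i = 0 then x else y) (if j = 0 then x else y))"
        unfolding Q_def
        by (rule remainder_psd[of 2 "\<lambda>i. if i = 0 then x else y" "\<lambda>i. if i = 0 then f y else - f x" m])
          (use that supp in auto)
      moreover have "Q y x = Q x y" using that by (simp add: Q_def K_sym mult_ac)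
      ultimately show ?thesis
        by (simp add: numeral_2_eq_2 power2_eq_square algebra_simps)
    qed
    have row: "0 \<le> s * Q x x - 2 * f x * N.T f x + (f x)\<^sup>2 * \<tau>" if x: "x \<in> X" for x
    proof -
      have "0 \<le> (\<integral>y. (f y)\<^sup>2 * Q x x - 2 * f x * (Q x y * f y) + (f x)\<^sup>2 * Q y y \<partial>\<nu>)"
        using pt[OF x] by (intro Bochner_Integration.integral_nonneg) auto
      also have "\<dots> = s * Q x x - 2 * f x * N.T f x + (f x)\<^sup>2 * \<tau>"
        using Qf[OF x] Qff Qint by (simp add: \<tau>_def)
      finally show ?thesis .
    qed
    have "0 \<le> (\<integral>x. s * Q x x - 2 * (N.T f x * f x) + (f x)\<^sup>2 * \<tau> \<partial>\<nu>)"
      using row by (intro Bochner_Integration.integral_nonneg) (simp add: mult_ac)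
    also have "\<dots> = s * \<tau> - 2 * N.ip (N.T f) f + s * \<tau>"
    proof -
      have "integrable \<nu> (\<lambda>x. N.T f x * f x)"
        by (intro N.continuous_integrable continuous_intros N.T_cont' fc)
      then show ?thesis using Qff Qint by (simp add: \<tau>_def N.ip_def)
    qed
    finally have "N.ip (N.T f) f \<le> \<tau> * s" by simp
    moreover have "L' m * s \<le> N.ip (N.T f) f"
      unfolding Tff s_def sum_distrib_left using decr by (intro sum_mono mult_right_mono) auto
    moreover have "0 < s"
    proof -
      obtain i where "i < Suc m" "c i \<noteq> 0" using c1 by blast
      then show ?thesis unfolding s_def by (intro sum_pos2[of _ i]) auto
    qed
    ultimately have "L' m \<le> \<tau>" by (metis mult_le_cancel_right_pos order_trans)
    then show ?thesis unfolding \<tau>_def Q_diag .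
  qed
qed

end

section \<open>Tails of the spectrum of a Gram matrix\<close>

text \<open>An orthonormal basis of n-dimensional space, that is, the rows of an orthogonal matrix,
  kept as a function of two indices so that only finite sums occur.\<close>

definition frame :: "nat \<Rightarrow> (nat \<Rightarrow> nat \<Rightarrow> real) \<Rightarrow> bool"
  where "frame n w \<longleftrightarrow> (\<forall>p<n. \<forall>q<n. (\<Sum>i<n. w p i * w q i) = (if p = q then 1 else 0))"

lemma frameD: "frame n w \<Longrightarrow> p < n \<Longrightarrow> q < n \<Longrightarrow> (\<Sum>i<n. w p i * w q i) = (if p = q then 1 else 0)"
  by (simp add: frame_def)

text \<open>A one-sided inverse of a square matrix is two-sided, so the columns are orthonormal as
  well as the rows.\<close>

lemma frame_complete:
  assumes "frame n w" "i < n" "j < n"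
  shows "(\<Sum>p<n. w p i * w p j) = (if i = j then 1 else 0)"
proof -
  define W where "W = mat n n (\<lambda>(p, i). w p i)"
  have W: "W \<in> carrier_mat n n" by (simp add: W_def)
  have "W * transpose_mat W = 1\<^sub>m n"
    using frameD[OF assms(1)]
    by (intro eq_matI) (auto simp: W_def scalar_prod_def lessThan_atLeast0)
  then have "transpose_mat W * W = 1\<^sub>m n"
    by (rule mat_mult_left_right_inverse[rotated 2]) (use W in auto)
  then have "index_mat (transpose_mat W * W) (i, j) = index_mat (1\<^sub>m n) (i, j)" by simp
  then show ?thesis
    using assms(2,3) by (auto simp: W_def scalar_prod_def lessThan_atLeast0 split: if_splits)
qed

lemma frame_parseval:
  assumes "frame n w"
  shows "(\<Sum>p<n. (\<Sum>i<n. w p i * a i)\<^sup>2) = (\<Sum>i<n. (a i)\<^sup>2)"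
proof -
  have "(\<Sum>p<n. (\<Sum>i<n. w p i * a i)\<^sup>2) = (\<Sum>p<n. \<Sum>i<n. \<Sum>j<n. a i * a j * (w p i * w p j))"
    by (simp add: power2_eq_square sum_product mult_ac)
  also have "\<dots> = (\<Sum>i<n. \<Sum>p<n. \<Sum>j<n. a i * a j * (w p i * w p j))"
    by (rule sum.swap)
  also have "\<dots> = (\<Sum>i<n. \<Sum>j<n. \<Sum>p<n. a i * a j * (w p i * w p j))"
    by (intro sum.cong refl sum.swap)
  also have "\<dots> = (\<Sum>i<n. \<Sum>j<n. a i * a j * (if i = j then 1 else 0))"
    using frame_complete[OF assms] by (simp add: sum_distrib_left[symmetric])
  also have "\<dots> = (\<Sum>i<n. (a i)\<^sup>2)"
    by (simp add: if_distrib[of "(*) _"] power2_eq_square cong: if_cong)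
  finally show ?thesis .
qed

lemma frame_trace:
  assumes "frame n w"
  shows "(\<Sum>p<n. \<Sum>i<n. \<Sum>j<n. w p i * w p j * b i j) = (\<Sum>i<n. b i i)"
proof -
  have "(\<Sum>p<n. \<Sum>i<n. \<Sum>j<n. w p i * w p j * b i j) = (\<Sum>i<n. \<Sum>p<n. \<Sum>j<n. w p i * w p j * b i j)"
    by (rule sum.swap)
  also have "\<dots> = (\<Sum>i<n. \<Sum>j<n. \<Sum>p<n. w p i * w p j * b i j)"
    by (intro sum.cong refl sum.swap)
  also have "\<dots> = (\<Sum>i<n. \<Sum>j<n. (if i = j then 1 else 0) * b i j)"
    using frame_complete[OF assms] by (simp add: sum_distrib_right[symmetric])
  also have "\<dots> = (\<Sum>i<n. b i i)"
    by (simp add: if_distrib[of "\<lambda>t. t * _"] cong: if_cong)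
  finally show ?thesis .
qed

text \<open>The vectors orthogonal to all \<open>a s\<close> are chosen before the others, while the
  count of conditions stays below \<open>n\<close>; reversing the order at the end gives them the
  indices from \<open>k\<close> on.\<close>

lemma frame_orthogonal_exists:
  fixes a :: "nat \<Rightarrow> nat \<Rightarrow> real"
  assumes "k < n"
  obtains w where "frame n w" "\<And>q s. k \<le> q \<Longrightarrow> q < n \<Longrightarrow> s < k \<Longrightarrow> (\<Sum>i<n. a s i * w q i) = 0"
proof -
  have "\<exists>v. (\<forall>p<m. \<forall>q<m. (\<Sum>i<n. v p i * v q i) = (if p = q then 1 else 0)) \<and>
      (\<forall>q<m. q < n - k \<longrightarrow> (\<forall>s<k. (\<Sum>i<n. a s i * v q i) = 0))" if "m \<le> n" for m
    using that
  proof (induction m)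
    case (Suc m)
    then obtain v where v: "\<forall>p<m. \<forall>q<m. (\<Sum>i<n. v p i * v q i) = (if p = q then 1 else 0)"
      and va: "\<forall>q<m. q < n - k \<longrightarrow> (\<forall>s<k. (\<Sum>i<n. a s i * v q i) = 0)"
      by auto
    \<comment> \<open>The number of conditions: orthogonality to the \<open>m\<close> vectors
      already chosen and, as long as \<open>m < n - k\<close>, also to the \<open>k\<close> vectors
      \<open>a s\<close>.\<close>
    define r where "r = (if m < n - k then m + k else m)"
    have "r < n" using Suc.prems by (auto simp: r_def)
    then obtain c where c: "\<exists>i<n. c i \<noteq> 0"
      and orth: "\<And>q. q < r \<Longrightarrow> (\<Sum>i<n. c i * (if q < m then v q i else a (q - m) i)) = 0"
      using underdetermined_system[of r n "\<lambda>q i. if q < m then v q i else a (q - m) i"] by blast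
    define s where "s = (\<Sum>i<n. (c i)\<^sup>2)"
    have "0 < s"
    proof -
      obtain i where "i < n" "c i \<noteq> 0" using c by blast
      then show ?thesis unfolding s_def by (intro sum_pos2[of _ i]) auto
    qed
    define g where "g i = c i / sqrt s" for i
    have gg: "(\<Sum>i<n. g i * g i) = 1"
    proof -
      have "(\<Sum>i<n. g i * g i) = (\<Sum>i<n. (c i)\<^sup>2 / s)"
        using \<open>0 < s\<close> by (intro sum.cong) (auto simp: g_def power2_eq_square)
      then show ?thesis using \<open>0 < s\<close> by (simp add: s_def sum_divide_distrib[symmetric])
    qed
    have gv: "(\<Sum>i<n. g i * v q i) = 0" "(\<Sum>i<n. v q i * g i) = 0" if "q < m" for q
      using orth[of q] that by (auto simp: g_def r_def sum_divide_distrib[symmetric] mult.commute)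
    have ga: "(\<Sum>i<n. a t i * g i) = 0" if "t < k" "m < n - k" for t
      using orth[of "m + t"] that by (simp add: g_def r_def sum_divide_distrib[symmetric] mult.commute)
    show ?case
      using v va gg gv ga by (intro exI[of _ "v(m := g)"]) (auto simp: less_Suc_eq)
  qed simp
  then obtain v where v: "\<And>p q. p < n \<Longrightarrow> q < n \<Longrightarrow> (\<Sum>i<n. v p i * v q i) = (if p = q then 1 else 0)"
    and va: "\<And>q s. q < n - k \<Longrightarrow> s < k \<Longrightarrow> (\<Sum>i<n. a s i * v q i) = 0"
    by (metis diff_le_self le_refl less_le_trans)
  show thesis
  proof (rule that[of "\<lambda>q. v (n - 1 - q)"])
    show "frame n (\<lambda>q. v (n - 1 - q))"
      unfolding frame_def using v by (auto intro!: v[THEN trans])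
    show "(\<Sum>i<n. a s i * v (n - 1 - q) i) = 0" if "k \<le> q" "q < n" "s < k" for q s
      using that by (intro va) auto
  qed
qed

text \<open>Conjugation by the orthogonal matrix of eigenvectors makes the matrix diagonal. This
  links eigenvectors to \<open>mat_eigenvalue\<close>, which is defined by roots of the
  characteristic polynomial.\<close>

lemma char_poly_frame:
  assumes w: "frame n w"
    and eigen: "\<And>p i. p < n \<Longrightarrow> i < n \<Longrightarrow> (\<Sum>j<n. b i j * w p j) = e p * w p i"
  shows "char_poly (mat n n (\<lambda>(i, j). b i j)) = (\<Prod>p\<leftarrow>[0..<n]. [:- e p, 1:])"
proof -
  define B where "B = mat n n (\<lambda>(i, j). b i j)"
  define W where "W = mat n n (\<lambda>(p, i). w p i)"
  define D where "D = mat n n (\<lambda>(p, q). if p = q then e p else 0)"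
  have [simp]: "B \<in> carrier_mat n n" "W \<in> carrier_mat n n" "D \<in> carrier_mat n n"
    by (simp_all add: B_def W_def D_def)
  have WW: "W * transpose_mat W = 1\<^sub>m n"
    using frameD[OF w]
    by (intro eq_matI) (auto simp: W_def scalar_prod_def lessThan_atLeast0)
  have WW': "transpose_mat W * W = 1\<^sub>m n"
    by (rule mat_mult_left_right_inverse[OF _ _ WW]) auto
  have BW: "B * transpose_mat W = transpose_mat W * D"
  proof (rule eq_matI)
    fix i p assume ip: "i < dim_row (transpose_mat W * D)" "p < dim_col (transpose_mat W * D)"
    then have i: "i < n" and p: "p < n" by (auto simp: W_def D_def)
    have "index_mat (transpose_mat W * D) (i, p) = (\<Sum>q<n. w q i * (if q = p then e q else 0))"
      using i p by (auto simp: W_def D_def scalar_prod_def lessThan_atLeast0)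
    also have "\<dots> = e p * w p i"
      using p by (simp add: if_distrib[of "(*) _"] cong: if_cong)
    also have "\<dots> = index_mat (B * transpose_mat W) (i, p)"
      using i p eigen[OF p i] by (auto simp: W_def B_def scalar_prod_def lessThan_atLeast0)
    finally show "index_mat (B * transpose_mat W) (i, p) = index_mat (transpose_mat W * D) (i, p)" by simp
  qed (auto simp: B_def W_def D_def)
  have "B = B * (transpose_mat W * W)" by (simp add: WW' right_mult_one_mat[of B n n])
  also have "\<dots> = transpose_mat W * D * W"
    by (subst assoc_mult_mat[symmetric, of _ n n _ n _ n]) (auto simp: BW)
  finally have B_eq: "B = transpose_mat W * D * W" .
  have "similar_mat B D"
    by (rule similar_matI[of _ _ "transpose_mat W" W n, OF _ WW' WW B_eq]) simp
  then have "char_poly B = char_poly D" by (rule char_poly_similar)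
  also have "\<dots> = (\<Prod>a\<leftarrow>diag_mat D. [:- a, 1:])"
    by (rule char_poly_upper_triangular[of _ n]) (auto simp: D_def)
  also have "diag_mat D = map e [0..<n]"
    by (auto simp: diag_mat_def D_def)
  finally show ?thesis by (simp add: B_def o_def)
qed

text \<open>The sorted roots and the eigenvalues \<open>e p\<close> form the same multiset, so a
  permutation of the frame puts eigenvectors and \<open>mat_eigenvalue\<close> in the same
  order.\<close>

lemma sorted_frame:
  assumes w: "frame n w"
    and eigen: "\<And>p i. p < n \<Longrightarrow> i < n \<Longrightarrow> (\<Sum>j<n. b i j * w p j) = e p * w p i"
  defines "eig \<equiv> \<lambda>p. mat_eigenvalue (mat n n (\<lambda>(i, j). b i j)) (Suc p)"
  obtains u where "frame n u" "\<And>p i. p < n \<Longrightarrow> i < n \<Longrightarrow> (\<Sum>j<n. b i j * u p j) = eig p * u p i"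
    "\<And>p q. p \<le> q \<Longrightarrow> q < n \<Longrightarrow> eig q \<le> eig p"
proof -
  define es where "es = map e [0..<n]"
  define ds where "ds = rev (sorted_list_of_multiset (mset es))"
  have "proots (char_poly (mat n n (\<lambda>(i, j). b i j))) = mset es"
  proof -
    have "proots (\<Prod>p\<leftarrow>xs. [:- e p, 1:]) = mset (map e xs)" for xs :: "nat list"
    proof (induction xs)
      case (Cons p xs)
      have "(\<Prod>p\<leftarrow>xs. [:- e p, 1:]) \<noteq> 0" by (auto simp: prod_list_zero_iff)
      then have "proots ([:- e p, 1:] * (\<Prod>p\<leftarrow>xs. [:- e p, 1:])) = {#e p#} + mset (map e xs)"
        by (subst proots_mult) (auto simp: Cons.IH)
      then show ?case by simp
    qed simp
    moreover have "char_poly (mat n n (\<lambda>(i, j). b i j)) = (\<Prod>p\<leftarrow>[0..<n]. [:- e p, 1:])"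
      by (rule char_poly_frame[OF w eigen])
    ultimately show ?thesis unfolding es_def by (simp only:)
  qed
  then have l_eq: "eig p = ds ! p" for p
    by (simp add: eig_def mat_eigenvalue_def ds_def)
  have "mset ds = mset es" by (simp add: ds_def del: sorted_list_of_multiset_mset)
  then obtain \<pi> where \<pi>: "\<pi> permutes {..<length es}" "permute_list \<pi> es = ds"
    by (rule mset_eq_permutation)
  have len: "length es = n" "length ds = n"
    using mset_eq_length[OF \<open>mset ds = mset es\<close>] by (simp_all add: es_def)
  have \<pi>n: "\<pi> p < n" if "p < n" for p
    using permutes_in_image[OF \<pi>(1), of p] that len by simp
  have ds_nth: "ds ! p = e (\<pi> p)" if "p < n" for p
    using permute_list_nth[OF \<pi>(1), of p] \<pi>(2) \<pi>n[OF that] that len by (simp add: es_def)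
  have inj: "\<pi> p = \<pi> q \<longleftrightarrow> p = q" for p q
    using permutes_inj[OF \<pi>(1)] by (auto dest: injD)
  show thesis
  proof (rule that[of "\<lambda>p. w (\<pi> p)"])
    show "frame n (\<lambda>p. w (\<pi> p))"
      using w \<pi>n inj by (auto simp: frame_def)
    show "(\<Sum>j<n. b i j * w (\<pi> p) j) = eig p * w (\<pi> p) i" if "p < n" "i < n" for p i
      using eigen[OF \<pi>n[OF that(1)] that(2)] that by (simp add: l_eq ds_nth)
    show "eig q \<le> eig p" if "p \<le> q" "q < n" for p q
    proof -
      have "sorted_wrt (\<ge>) ds"
        unfolding ds_def sorted_wrt_rev using sorted_sorted_list_of_multiset by simp
      then show ?thesis
        using that len by (cases "p = q") (auto simp: l_eq sorted_wrt_iff_nth_less)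
    qed
  qed
qed

text \<open>
  Ky Fan's principle: \<open>c p\<close> below is the squared length of the projection of \<open>u p\<close> to the span of the
  \<open>w q\<close> with \<open>k \<le> q\<close>, so that \<open>0 \<le> c p \<le> 1\<close> and the \<open>c p\<close> add up to \<open>n - k\<close>.
\<close>

lemma tail_sum_le:
  assumes u: "frame n u" and eigen: "\<And>p i. p < n \<Longrightarrow> i < n \<Longrightarrow> (\<Sum>j<n. b i j * u p j) = l p * u p i"
    and decr: "\<And>p q. p \<le> q \<Longrightarrow> q < n \<Longrightarrow> l q \<le> l p"
    and w: "frame n w" and "k < n"
  shows "(\<Sum>p=k..<n. l p) \<le> (\<Sum>q=k..<n. \<Sum>i<n. \<Sum>j<n. w q i * w q j * b i j)"
proof -
  define c where "c p = (\<Sum>q=k..<n. (\<Sum>i<n. u p i * w q i)\<^sup>2)" for p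
  \<comment> \<open>The spectral decomposition: the eigenvalue equations on a complete frame
    determine the matrix.\<close>
  have b_eq: "b i j = (\<Sum>p<n. l p * (u p i * u p j))" if ij: "i < n" "j < n" for i j
  proof -
    have "(\<Sum>p<n. l p * (u p i * u p j)) = (\<Sum>p<n. \<Sum>s<n. b i s * (u p s * u p j))"
    proof (intro sum.cong refl)
      fix p assume "p \<in> {..<n}"
      then have "l p * (u p i * u p j) = (\<Sum>s<n. b i s * u p s) * u p j"
        using eigen[of p i] ij by simp
      then show "l p * (u p i * u p j) = (\<Sum>s<n. b i s * (u p s * u p j))"
        by (simp add: sum_distrib_right mult.assoc)
    qed
    also have "\<dots> = (\<Sum>s<n. \<Sum>p<n. b i s * (u p s * u p j))" by (rule sum.swap)
    also have "\<dots> = (\<Sum>s<n. b i s * (if s = j then 1 else 0))"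
      using frame_complete[OF u] ij by (simp add: sum_distrib_left[symmetric])
    also have "\<dots> = b i j"
      using ij by (simp add: if_distrib[of "(*) _"] cong: if_cong)
    finally show ?thesis by simp
  qed
  have form: "(\<Sum>i<n. \<Sum>j<n. w q i * w q j * b i j) = (\<Sum>p<n. l p * (\<Sum>i<n. u p i * w q i)\<^sup>2)" for q
  proof -
    let ?t = "\<lambda>i j p. l p * ((u p i * w q i) * (u p j * w q j))"
    have "(\<Sum>i<n. \<Sum>j<n. w q i * w q j * b i j) = (\<Sum>i<n. \<Sum>j<n. \<Sum>p<n. ?t i j p)"
      by (intro sum.cong refl) (simp add: b_eq sum_distrib_left mult_ac)
    also have "\<dots> = (\<Sum>i<n. \<Sum>p<n. \<Sum>j<n. ?t i j p)"
      by (intro sum.cong refl sum.swap)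
    also have "\<dots> = (\<Sum>p<n. \<Sum>i<n. \<Sum>j<n. ?t i j p)"
      by (rule sum.swap)
    also have "\<dots> = (\<Sum>p<n. l p * (\<Sum>i<n. u p i * w q i)\<^sup>2)"
    proof (intro sum.cong refl)
      fix p
      have "(\<Sum>i<n. u p i * w q i)\<^sup>2 = (\<Sum>i<n. \<Sum>j<n. (u p i * w q i) * (u p j * w q j))"
        unfolding power2_eq_square by (rule sum_product)
      then show "(\<Sum>i<n. \<Sum>j<n. ?t i j p) = l p * (\<Sum>i<n. u p i * w q i)\<^sup>2"
        by (simp only: sum_distrib_left)
    qed
    finally show ?thesis .
  qed
  have total: "(\<Sum>q=k..<n. \<Sum>i<n. \<Sum>j<n. w q i * w q j * b i j) = (\<Sum>p<n. l p * c p)"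
    unfolding form c_def sum_distrib_left by (rule sum.swap)
  have c_nonneg: "0 \<le> c p" for p by (auto simp: c_def intro!: sum_nonneg)
  have c_le: "c p \<le> 1" if "p < n" for p
  proof -
    have "c p \<le> (\<Sum>q<n. (\<Sum>i<n. w q i * u p i)\<^sup>2)"
      unfolding c_def by (subst mult.commute, intro sum_mono2) auto
    also have "\<dots> = 1"
      using frame_parseval[OF w, of "u p"] frameD[OF u that that] by (simp add: power2_eq_square)
    finally show ?thesis .
  qed
  have c_sum: "(\<Sum>p<n. c p) = real (n - k)"
  proof -
    have "(\<Sum>p<n. c p) = (\<Sum>q=k..<n. \<Sum>p<n. (\<Sum>i<n. u p i * w q i)\<^sup>2)"
      unfolding c_def by (rule sum.swap)
    also have "\<dots> = (\<Sum>q=k..<n. 1)"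
      using frame_parseval[OF u] frameD[OF w] by (intro sum.cong refl) (auto simp: power2_eq_square)
    finally show ?thesis by simp
  qed
  \<comment> \<open>The deviation of the weights \<open>c p\<close> from the indicator of
    \<open>k \<le> p\<close>. It sums to 0, so every \<open>l p\<close> may be compared with
    \<open>l k\<close>; the signs of \<open>d p\<close> and of \<open>l p - l k\<close> agree on
    either side of \<open>k\<close>.\<close>
  define d where "d p = c p - (if k \<le> p then 1 else 0)" for p
  have "(\<Sum>p<n. d p) = (\<Sum>p<n. c p) - (\<Sum>p<n. if k \<le> p then 1 else 0)"
    by (simp add: d_def sum_subtractf)
  also have "(\<Sum>p<n. if k \<le> p then 1 else 0 :: real) = (\<Sum>p=k..<n. 1)"
    by (rule sum.mono_neutral_cong_right) auto
  finally have "(\<Sum>p<n. d p) = 0" using c_sum by simp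
  then have "0 = (\<Sum>p<n. l k * d p)" by (simp add: sum_distrib_left[symmetric])
  also have "\<dots> \<le> (\<Sum>p<n. l p * d p)"
  proof (rule sum_mono)
    fix p assume p: "p \<in> {..<n}"
    show "l k * d p \<le> l p * d p"
    proof (cases "k \<le> p")
      case True
      then show ?thesis using p decr[of k p] c_le[of p] by (intro mult_right_mono_neg) (auto simp: d_def)
    next
      case False
      then show ?thesis using \<open>k < n\<close> decr[of p k] c_nonneg[of p] by (intro mult_right_mono) (auto simp: d_def)
    qed
  qed
  also have "\<dots> = (\<Sum>p<n. l p * c p) - (\<Sum>p<n. if k \<le> p then l p else 0)"
    by (simp add: d_def sum_subtractf[symmetric] right_diff_distrib if_distrib[of "(*) _"] cong: if_cong)
  also have "(\<Sum>p<n. if k \<le> p then l p else 0) = (\<Sum>p=k..<n. l p)"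
    by (rule sum.mono_neutral_cong_right) auto
  finally show ?thesis unfolding total by simp
qed

text \<open>
  The Gram matrix is the integral operator of the empirical measure, realised on the index set
  \<open>{0, \<dots>, n - 1}\<close> because the sample points may coincide.
\<close>

lemma gram_frame_exists:
  fixes x :: "nat \<Rightarrow> 'a::topological_space"
  assumes mercer: "mercer_kernel X K" and n: "0 < n" and x: "\<And>i. i < n \<Longrightarrow> x i \<in> X"
  obtains w e where "frame n w"
    "\<And>p i. p < n \<Longrightarrow> i < n \<Longrightarrow> (\<Sum>j<n. K (x i) (x j) / real n * w p j) = e p * w p i"
proof -
  \<comment> \<open>The indices are embedded in the reals because \<open>mercer_space\<close> asks
    for a Euclidean space, and \<open>k\<close> decodes them. On a finite set every function is
    continuous.\<close>
  define Y where "Y = real ` {..<n}"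
  define k where "k s = nat \<lfloor>s::real\<rfloor>" for s
  define G where "G s t = K (x (k s)) (x (k t))" for s t
  have k_real [simp]: "k (real i) = i" for i by (simp add: k_def)
  have kY: "k s < n" if "s \<in> Y" for s using that by (auto simp: Y_def)
  have finY: "finite Y" and Y0: "Y \<noteq> {}" and cardY: "card Y = n"
    using n by (auto simp: Y_def card_image)
  have cont: "continuous_on Y f" for f :: "real \<Rightarrow> real"
    by (rule continuous_on_finite[OF finY])
  have "mercer_kernel Y G"
    unfolding mercer_kernel_def
  proof (intro conjI ballI allI impI)
    show "continuous_on (Y \<times> Y) (\<lambda>(s, t). G s t)"
      by (intro continuous_on_finite finite_cartesian_product finY)
    show "G s t = G t s" if "s \<in> Y" "t \<in> Y" for s t
      using mercer x kY that by (auto simp: G_def mercer_kernel_def)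
    fix N :: nat and s :: "nat \<Rightarrow> real" and c :: "nat \<Rightarrow> real" assume "\<forall>i<N. s i \<in> Y"
    then have "\<forall>i<N. x (k (s i)) \<in> X" using x kY by auto
    moreover have "\<forall>(n::nat) x c. (\<forall>i<n. x i \<in> X) \<longrightarrow> 0 \<le> (\<Sum>i<n. \<Sum>j<n. c i * c j * K (x i) (x j))"
      using mercer unfolding mercer_kernel_def by blast
    ultimately show "0 \<le> (\<Sum>i<N. \<Sum>j<N. c i * c j * G (s i) (s j))"
      unfolding G_def by simp
  qed
  moreover have "borel_prob_on Y (uniform_count_measure Y)"
  proof -
    have "sets (restrict_space borel Y) = Pow Y"
    proof
      show "Pow Y \<subseteq> sets (restrict_space borel Y)"
      proof
        fix A assume "A \<in> Pow Y"
        then have "finite A" "Y \<inter> A = A" using finY finite_subset by auto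
        then show "A \<in> sets (restrict_space borel Y)"
          unfolding sets_restrict_space
          by (intro image_eqI[of _ _ A] borel_closed finite_imp_closed) auto
      qed
    qed (auto simp: sets_restrict_space)
    then show ?thesis
      unfolding borel_prob_on_def
      using prob_space_uniform_count_measure[OF finY Y0] by (simp add: sets_uniform_count_measure)
  qed
  ultimately interpret M: mercer_space Y G "uniform_count_measure Y"
    using finY by unfold_locales (auto intro: finite_imp_compact)
  have int_eq: "(\<integral>s. f s \<partial>uniform_count_measure Y) = (\<Sum>i<n. f (real i)) / real n" for f :: "real \<Rightarrow> real"
    by (simp add: integral_uniform_count_measure[OF finY] cardY) (simp add: Y_def sum.reindex inj_on_def)
  have ip_eq: "M.ip f g = (\<Sum>i<n. f (real i) * g (real i)) / real n" for f g
    by (simp add: M.ip_def int_eq)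
  have "\<exists>v e. (\<forall>p<m. \<forall>s\<in>Y. M.T (v p) s = e p * v p s) \<and>
      (\<forall>p<m. \<forall>q<m. M.ip (v p) (v q) = (if p = q then 1 else 0))" if "m \<le> n" for m
    using that
  proof (induction m)
    case (Suc m)
    then obtain v e where v: "\<And>p s. p < m \<Longrightarrow> s \<in> Y \<Longrightarrow> M.T (v p) s = e p * v p s"
      and on: "\<And>p q. p < m \<Longrightarrow> q < m \<Longrightarrow> M.ip (v p) (v q) = (if p = q then 1 else 0)"
      by (metis Suc_leD)
    define H where "H = {f. continuous_on Y f \<and> (\<forall>j\<in>{..<m}. M.ip (v j) f = 0)}"
    \<comment> \<open>The \<open>n\<close> indicator functions are independent, so fewer than
      \<open>n\<close> orthogonality conditions leave a unit vector.\<close>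
    define \<delta> where "\<delta> i s = (if k s = i then 1 else 0 :: real)" for i s
    have \<delta>_sum: "(\<Sum>i<n. c i * \<delta> i (real j)) = c j" if "j < n" for c j
      using that by (simp add: \<delta>_def if_distrib[of "(*) _"] cong: if_cong)
    have "\<exists>f. f \<in> H \<and> M.ip f f = 1"
    proof -
      have indep: "\<forall>i<n. c i = 0"
        if "M.ip (\<lambda>s. \<Sum>i<n. c i * \<delta> i s) (\<lambda>s. \<Sum>i<n. c i * \<delta> i s) = 0" for c
      proof -
        have "(\<Sum>j<n. c j * c j) = 0"
          using that n by (simp add: ip_eq \<delta>_sum)
        then show ?thesis by (subst (asm) sum_nonneg_eq_0_iff) auto
      qed
      show ?thesis
        by (rule M.orthonormal_step[of n \<delta> m v]) (use indep Suc.prems cont in \<open>auto simp: H_def\<close>)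
    qed
    then obtain f where f: "f \<in> H" "M.ip f f = 1" by blast
    \<comment> \<open>\<open>rayleigh_max\<close> needs a vector with positive form. If the form of
      \<open>f\<close> is 0, \<open>T_pointwise\<close> makes \<open>f\<close> itself an eigenvector
      with eigenvalue 0.\<close>
    have "\<exists>g t. g \<in> H \<and> M.ip g g = 1 \<and> (\<forall>s\<in>Y. M.T g s = t * g s)"
    proof (cases "0 < M.ip (M.T f) f")
      case True
      show ?thesis
        by (rule M.rayleigh_max[of "{..<m}" v e f]) (use True f cont v in \<open>auto simp: H_def\<close>)
    next
      case False
      then have "M.ip (M.T f) f = 0" using M.T_nonneg[OF cont, of f] by simp
      then have "M.T f s = 0" if "s \<in> Y" for s
        using M.T_pointwise[OF cont that, of f] by simp
      then show ?thesis using f by (intro exI[of _ f] exI[of _ 0]) auto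
    qed
    then obtain g t where g: "g \<in> H" "M.ip g g = 1" "\<forall>s\<in>Y. M.T g s = t * g s" by blast
    have "M.ip (v q) g = 0" "M.ip g (v q) = 0" if "q < m" for q
      using g(1) that by (auto simp: H_def M.ip_commute[of g])
    then show ?case
      using v on g by (intro exI[of _ "v(m := g)"] exI[of _ "e(m := t)"]) (auto simp: less_Suc_eq)
  qed simp
  then obtain v e where v: "\<And>p s. p < n \<Longrightarrow> s \<in> Y \<Longrightarrow> M.T (v p) s = e p * v p s"
    and on: "\<And>p q. p < n \<Longrightarrow> q < n \<Longrightarrow> M.ip (v p) (v q) = (if p = q then 1 else 0)"
    by (metis le_refl)
  show thesis
  \<comment> \<open>The inner product of the uniform measure carries a factor \<open>1 / n\<close>,
    which \<open>sqrt n\<close> compensates.\<close>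
  proof (rule that[of "\<lambda>p i. v p (real i) / sqrt (real n)" e])
    show "frame n (\<lambda>p i. v p (real i) / sqrt (real n))"
      using on n by (simp add: frame_def ip_eq sum_divide_distrib[symmetric])
    show "(\<Sum>j<n. K (x i) (x j) / real n * (v p (real j) / sqrt (real n))) = e p * (v p (real i) / sqrt (real n))"
      if "p < n" "i < n" for p i
    proof -
      have "real i \<in> Y" using that by (auto simp: Y_def)
      from v[OF that(1) this] have "(\<Sum>j<n. K (x i) (x j) * v p (real j)) / real n = e p * v p (real i)"
        by (simp add: kernel_op_def int_eq G_def)
      moreover have "(\<Sum>j<n. K (x i) (x j) / real n * (v p (real j) / sqrt (real n)))
          = (\<Sum>j<n. K (x i) (x j) * v p (real j)) / real n / sqrt (real n)"
        by (simp add: sum_divide_distrib)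
      ultimately show ?thesis by simp
    qed
  qed
qed

section \<open>Ky Fan's principle for Gram matrices\<close>

lemma frame_identity: "frame n (\<lambda>p i. if p = i then 1 else 0)"
  by (auto simp: frame_def if_distrib[of "(*) _"] cong: if_cong)

text \<open>For a frame \<open>w\<close>, the trace of the compression of \<open>b\<close> to the
  span of the \<open>w q\<close> with \<open>k \<le> q < n\<close>. It is linear in
  \<open>b\<close>.\<close>

definition frame_form :: "nat \<Rightarrow> nat \<Rightarrow> (nat \<Rightarrow> nat \<Rightarrow> real) \<Rightarrow> (nat \<Rightarrow> nat \<Rightarrow> real) \<Rightarrow> real"
  where "frame_form n k w b = (\<Sum>q=k..<n. \<Sum>i<n. \<Sum>j<n. w q i * w q j * b i j)"

lemma frame_form_identity:
  "frame_form n k (\<lambda>p i. if p = i then 1 else 0) b = (\<Sum>q=k..<n. b q q)"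
  unfolding frame_form_def
proof (intro sum.cong refl)
  fix q assume q: "q \<in> {k..<n}"
  have "(\<Sum>i<n. \<Sum>j<n. (if q = i then 1 else 0) * (if q = j then 1 else 0) * b i j)
    = (\<Sum>i<n. if q = i then (\<Sum>j<n. if q = j then b i j else 0) else 0)"
    by (intro sum.cong refl) (auto intro!: sum.cong simp del: sum.delta sum.delta')
  also have "\<dots> = b q q"
    using q by simp
  finally show "(\<Sum>i<n. \<Sum>j<n. (if q = i then 1 else 0) * (if q = j then 1 else 0) * b i j) = b q q" .
qed

context
  fixes X :: "'a::topological_space set" and K :: "'a \<Rightarrow> 'a \<Rightarrow> real" and n k :: nat and x :: "nat \<Rightarrow> 'a"
  assumes mercer: "mercer_kernel X K" and k: "k < n" and x: "\<And>i. i < n \<Longrightarrow> x i \<in> X"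
begin

lemma gram_sorted_frame:
  obtains u where "frame n u"
    "\<And>p i. p < n \<Longrightarrow> i < n \<Longrightarrow>
      (\<Sum>j<n. K (x i) (x j) / real n * u p j) = mat_eigenvalue (gram_mat K n x) (Suc p) * u p i"
    "\<And>p q. p \<le> q \<Longrightarrow> q < n \<Longrightarrow>
      mat_eigenvalue (gram_mat K n x) (Suc q) \<le> mat_eigenvalue (gram_mat K n x) (Suc p)"
proof -
  have "0 < n" using k by simp
  obtain w e where we: "frame n w"
    "\<And>p i. p < n \<Longrightarrow> i < n \<Longrightarrow> (\<Sum>j<n. K (x i) (x j) / real n * w p j) = e p * w p i"
    using gram_frame_exists[of X K n x, OF mercer \<open>0 < n\<close> x] by blast
  show thesis
    using sorted_frame[of n w "\<lambda>i j. K (x i) (x j) / real n" e, OF we] that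
    unfolding gram_mat_def by blast
qed

lemma gram_tail_frame_le:
  assumes "frame n w"
  shows "(\<Sum>p=k..<n. mat_eigenvalue (gram_mat K n x) (Suc p))
    \<le> frame_form n k w (\<lambda>i j. K (x i) (x j) / real n)"
proof -
  obtain u where u: "frame n u"
    "\<And>p i. p < n \<Longrightarrow> i < n \<Longrightarrow>
      (\<Sum>j<n. K (x i) (x j) / real n * u p j) = mat_eigenvalue (gram_mat K n x) (Suc p) * u p i"
    "\<And>p q. p \<le> q \<Longrightarrow> q < n \<Longrightarrow>
      mat_eigenvalue (gram_mat K n x) (Suc q) \<le> mat_eigenvalue (gram_mat K n x) (Suc p)"
    using gram_sorted_frame by blast
  show ?thesis
    unfolding frame_form_def by (rule tail_sum_le[OF u assms k])
qed

text \<open>The sorted eigenvectors give equality, so together with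
  \<open>gram_tail_frame_le\<close> the tail is the minimum of \<open>frame_form\<close> over all
  frames.\<close>

lemma gram_tail_attained:
  obtains w where "frame n w" "(\<Sum>p=k..<n. mat_eigenvalue (gram_mat K n x) (Suc p))
    = frame_form n k w (\<lambda>i j. K (x i) (x j) / real n)"
proof -
  obtain u where u: "frame n u"
    "\<And>p i. p < n \<Longrightarrow> i < n \<Longrightarrow>
      (\<Sum>j<n. K (x i) (x j) / real n * u p j) = mat_eigenvalue (gram_mat K n x) (Suc p) * u p i"
    "\<And>p q. p \<le> q \<Longrightarrow> q < n \<Longrightarrow>
      mat_eigenvalue (gram_mat K n x) (Suc q) \<le> mat_eigenvalue (gram_mat K n x) (Suc p)"
    using gram_sorted_frame by blast
  have "(\<Sum>i<n. \<Sum>j<n. u p i * u p j * (K (x i) (x j) / real n)) = mat_eigenvalue (gram_mat K n x) (Suc p)"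
    if p: "p < n" for p
  proof -
    have "(\<Sum>i<n. \<Sum>j<n. u p i * u p j * (K (x i) (x j) / real n))
        = (\<Sum>i<n. u p i * (\<Sum>j<n. K (x i) (x j) / real n * u p j))"
      by (simp add: sum_distrib_left mult_ac)
    also have "\<dots> = (\<Sum>i<n. mat_eigenvalue (gram_mat K n x) (Suc p) * (u p i * u p i))"
      using u(2)[OF p] by (intro sum.cong refl) (simp add: mult_ac)
    also have "\<dots> = mat_eigenvalue (gram_mat K n x) (Suc p)"
      using frameD[OF u(1) p p] by (simp add: sum_distrib_left[symmetric])
    finally show ?thesis .
  qed
  then show thesis
    by (intro that[OF u(1)]) (simp add: frame_form_def)
qed

lemma gram_tail_nonneg: "0 \<le> (\<Sum>p=k..<n. mat_eigenvalue (gram_mat K n x) (Suc p))"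
proof -
  have "\<forall>(n::nat) x c. (\<forall>i<n. x i \<in> X) \<longrightarrow> 0 \<le> (\<Sum>i<n. \<Sum>j<n. c i * c j * K (x i) (x j))"
    using mercer unfolding mercer_kernel_def by blast
  then have psd: "0 \<le> (\<Sum>i<n. \<Sum>j<n. c i * c j * K (x i) (x j))" for c :: "nat \<Rightarrow> real"
    using x by simp
  obtain w where "(\<Sum>p=k..<n. mat_eigenvalue (gram_mat K n x) (Suc p))
      = frame_form n k w (\<lambda>i j. K (x i) (x j) / real n)"
    using gram_tail_attained by blast
  also have "\<dots> = (\<Sum>q=k..<n. (\<Sum>i<n. \<Sum>j<n. w q i * w q j * K (x i) (x j)) / real n)"
    by (simp add: frame_form_def sum_divide_distrib)
  also have "\<dots> \<ge> 0"
    by (rule sum_nonneg, rule divide_nonneg_nonneg, rule psd) simp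
  finally show ?thesis .
qed

end

lemma gram_tail_eq:
  assumes "1 \<le> k"
  shows "gram_tail K n S k \<omega> = (\<Sum>p=k-1..<n. mat_eigenvalue (gram_mat K n (\<lambda>i. S i \<omega>)) (Suc p))"
proof -
  have "gram_tail K n S k \<omega> = (\<Sum>p\<in>Suc ` {k-1..<n}. mat_eigenvalue (gram_mat K n (\<lambda>i. S i \<omega>)) p)"
    using assms unfolding gram_tail_def image_Suc_atLeastLessThan
    by (simp add: atLeastLessThanSuc_atLeastAtMost)
  then show ?thesis by (subst (asm) sum.reindex) (simp_all add: o_def)
qed

section \<open>The spectral tail as a random variable\<close>

context mercer_space
begin

text \<open>
  The tail is a minimum of linear functions of the matrix, hence upper semicontinuous.
\<close>

lemma gram_tail_measurable:
  assumes S: "\<And>i. i < n \<Longrightarrow> S i \<in> measurable M \<mu>" and k: "1 \<le> k" "k \<le> n"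
  shows "gram_tail K n S k \<in> borel_measurable M"
proof -
  have k': "k - 1 < n" using k by simp
  have SX: "S i \<omega> \<in> X" if "i < n" "\<omega> \<in> space M" for i \<omega>
    using measurable_space[OF S[OF that(1)] that(2)] by simp
  \<comment> \<open>The matrix is padded by zeros to a function on all index pairs, whose
    measurability can be checked coordinatewise.\<close>
  define b where "b \<omega> ij = (if fst ij < n \<and> snd ij < n then K (S (fst ij) \<omega>) (S (snd ij) \<omega>) / real n else 0)"
    for \<omega> and ij :: "nat \<times> nat"
  have "(\<lambda>\<omega>. K (S i \<omega>) (S j \<omega>)) \<in> borel_measurable M" if "i < n" "j < n" for i j
    using measurable_compose[OF measurable_Pair[OF S[OF that(1)] S[OF that(2)]] continuous_measurable_pair[OF K_cont]]
    by simp
  then have "(\<lambda>\<omega>. b \<omega> ij) \<in> borel_measurable M" for ij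
    by (cases "fst ij < n \<and> snd ij < n") (auto simp: b_def)
  then have b: "b \<in> borel_measurable M"
    by (rule measurable_coordinatewise_then_product)
  define F where "F w c = frame_form n (k - 1) w (\<lambda>i j. c (i, j))" for w and c :: "nat \<times> nat \<Rightarrow> real"
  have "continuous_on UNIV (F w)" for w
    unfolding F_def frame_form_def by (intro continuous_intros continuous_on_product_coordinates)
  then have open_F: "open {c. F w c < a}" for w a
    using open_Collect_less[of "F w" "\<lambda>_. a"] by auto
  have F_b: "F w (b \<omega>) = frame_form n (k - 1) w (\<lambda>i j. K (S i \<omega>) (S j \<omega>) / real n)" for w \<omega>
    unfolding F_def frame_form_def by (intro sum.cong refl) (auto simp: b_def)
  show ?thesis
    unfolding borel_measurable_iff_less
  proof
    fix a
    \<comment> \<open>The union over frames is uncountable, but it is a union of open sets, hence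
      open.\<close>
    have "{\<omega> \<in> space M. gram_tail K n S k \<omega> < a} = b -` (\<Union>w\<in>{w. frame n w}. {c. F w c < a}) \<inter> space M"
    proof (intro equalityI subsetI)
      fix \<omega> assume "\<omega> \<in> {\<omega> \<in> space M. gram_tail K n S k \<omega> < a}"
      then have \<omega>: "\<omega> \<in> space M" and less: "gram_tail K n S k \<omega> < a" by auto
      obtain w where "frame n w" "gram_tail K n S k \<omega> = F w (b \<omega>)"
        using gram_tail_attained[OF mercer k', of "\<lambda>i. S i \<omega>"] SX \<omega>
        unfolding F_b gram_tail_eq[OF k(1)] by blast
      then show "\<omega> \<in> b -` (\<Union>w\<in>{w. frame n w}. {c. F w c < a}) \<inter> space M"
        using less \<omega> by auto
    next
      fix \<omega> assume "\<omega> \<in> b -` (\<Union>w\<in>{w. frame n w}. {c. F w c < a}) \<inter> space M"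
      then obtain w where \<omega>: "\<omega> \<in> space M" and w: "frame n w" "F w (b \<omega>) < a" by auto
      have "gram_tail K n S k \<omega> \<le> F w (b \<omega>)"
        unfolding F_b gram_tail_eq[OF k(1)]
        by (rule gram_tail_frame_le[OF mercer k' _ w(1)]) (use SX \<omega> in auto)
      then show "\<omega> \<in> {\<omega> \<in> space M. gram_tail K n S k \<omega> < a}" using \<omega> w(2) by auto
    qed
    also have "\<dots> \<in> sets M"
      by (intro measurable_sets[OF b] borel_open open_UN ballI open_F)
    finally show "{\<omega> \<in> space M. gram_tail K n S k \<omega> < a} \<in> sets M" .
  qed
qed

text \<open>The identity frame bounds the tail by a sum of diagonal entries, which are bounded by
  \<open>\<kappa> / n\<close>.\<close>

lemma gram_tail_integrable:
  assumes "prob_space M" and S: "\<And>i. i < n \<Longrightarrow> S i \<in> measurable M \<mu>" and k: "1 \<le> k" "k \<le> n"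
  shows "integrable M (gram_tail K n S k)"
proof -
  interpret M: prob_space M by fact
  obtain \<kappa> where \<kappa>: "0 \<le> \<kappa>" "\<And>x y. x \<in> X \<Longrightarrow> y \<in> X \<Longrightarrow> \<bar>K x y\<bar> \<le> \<kappa>"
    using K_bounded by blast
  have k': "k - 1 < n" using k by simp
  have "norm (gram_tail K n S k \<omega>) \<le> (\<Sum>q=k-1..<n. \<kappa> / real n)" if \<omega>: "\<omega> \<in> space M" for \<omega>
  proof -
    have SX: "S i \<omega> \<in> X" if "i < n" for i
      using measurable_space[OF S[OF that] \<omega>] by simp
    have "gram_tail K n S k \<omega> \<le> frame_form n (k - 1) (\<lambda>p i. if p = i then 1 else 0)
        (\<lambda>i j. K (S i \<omega>) (S j \<omega>) / real n)"
      unfolding gram_tail_eq[OF k(1)]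
      by (rule gram_tail_frame_le[OF mercer k' SX frame_identity])
    also have "\<dots> = (\<Sum>q=k-1..<n. K (S q \<omega>) (S q \<omega>) / real n)"
      by (rule frame_form_identity)
    also have "\<dots> \<le> (\<Sum>q=k-1..<n. \<kappa> / real n)"
      using SX \<kappa>(2) by (intro sum_mono divide_right_mono) (auto simp: abs_le_iff)
    finally have "gram_tail K n S k \<omega> \<le> (\<Sum>q=k-1..<n. \<kappa> / real n)" .
    moreover have "0 \<le> gram_tail K n S k \<omega>"
      unfolding gram_tail_eq[OF k(1)] by (rule gram_tail_nonneg[OF mercer k' SX])
    ultimately show ?thesis by (simp only: real_norm_def abs_of_nonneg)
  qed
  then show ?thesis
    by (intro M.integrable_const_bound[OF AE_I2] gram_tail_measurable S k)
qed

end

context eigensystem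
begin

text \<open>A frame is chosen whose vectors from index \<open>k\<close> on are orthogonal to the
  sampled values of the first \<open>k\<close> functions \<open>u s\<close>. On these vectors the
  forms of \<open>K\<close> and of the remainder coincide.\<close>

lemma gram_tail_le_remainder:
  fixes x :: "nat \<Rightarrow> 'a"
  assumes k: "k < n" and x: "\<And>i. i < n \<Longrightarrow> x i \<in> measure_support \<mu>"
  shows "(\<Sum>p=k..<n. mat_eigenvalue (gram_mat K n x) (Suc p))
    \<le> (\<Sum>i<n. (K (x i) (x i) - (\<Sum>p<k. L p * (u p (x i))\<^sup>2)) / real n)"
proof -
  have xX: "x i \<in> X" if "i < n" for i using x[OF that] by (auto simp: measure_support_def)
  define Q where "Q i j = K (x i) (x j) - (\<Sum>p<k. L p * u p (x i) * u p (x j))" for i j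
  obtain w where w: "frame n w"
    and orth: "\<And>q s. k \<le> q \<Longrightarrow> q < n \<Longrightarrow> s < k \<Longrightarrow> (\<Sum>i<n. u s (x i) * w q i) = 0"
    using frame_orthogonal_exists[OF k, of "\<lambda>s i. u s (x i)"] by blast
  have Q_form: "(\<Sum>i<n. \<Sum>j<n. w q i * w q j * (K (x i) (x j) / real n))
      = (\<Sum>i<n. \<Sum>j<n. w q i * w q j * (Q i j / real n))" if q: "k \<le> q" "q < n" for q
  proof -
    let ?t = "\<lambda>i j p. L p * ((u p (x i) * w q i) * (u p (x j) * w q j))"
    have "(\<Sum>i<n. \<Sum>j<n. \<Sum>p<k. ?t i j p) = (\<Sum>i<n. \<Sum>p<k. \<Sum>j<n. ?t i j p)"
      by (intro sum.cong refl sum.swap)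
    also have "\<dots> = (\<Sum>i<n. \<Sum>p<k. L p * ((u p (x i) * w q i) * (\<Sum>j<n. u p (x j) * w q j)))"
      by (simp only: sum_distrib_left)
    also have "\<dots> = 0" using orth[OF q] by simp
    finally have 0: "(\<Sum>i<n. \<Sum>j<n. \<Sum>p<k. ?t i j p) = 0" .
    have "(\<Sum>i<n. \<Sum>j<n. w q i * w q j * (Q i j / real n))
      = (\<Sum>i<n. \<Sum>j<n. w q i * w q j * (K (x i) (x j) / real n) - (\<Sum>p<k. ?t i j p) / real n)"
      by (intro sum.cong refl) (simp add: Q_def diff_divide_distrib right_diff_distrib sum_distrib_left mult_ac)
    also have "\<dots> = (\<Sum>i<n. \<Sum>j<n. w q i * w q j * (K (x i) (x j) / real n)) - (\<Sum>i<n. \<Sum>j<n. \<Sum>p<k. ?t i j p) / real n"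
      by (simp only: sum_subtractf sum_divide_distrib)
    finally show ?thesis using 0 by simp
  qed
  have Q_nonneg: "0 \<le> (\<Sum>i<n. \<Sum>j<n. w q i * w q j * (Q i j / real n))" for q
  proof -
    have "0 \<le> (\<Sum>i<n. \<Sum>j<n. w q i * w q j * Q i j)"
      unfolding Q_def by (rule remainder_psd[OF x])
    then have "0 \<le> (\<Sum>i<n. \<Sum>j<n. w q i * w q j * Q i j) / real n" by simp
    then show ?thesis by (simp add: sum_divide_distrib)
  qed
  have "(\<Sum>p=k..<n. mat_eigenvalue (gram_mat K n x) (Suc p))
      \<le> frame_form n k w (\<lambda>i j. K (x i) (x j) / real n)"
    by (rule gram_tail_frame_le[OF mercer k xX w])
  also have "\<dots> = (\<Sum>q=k..<n. \<Sum>i<n. \<Sum>j<n. w q i * w q j * (Q i j / real n))"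
    unfolding frame_form_def by (intro sum.cong refl Q_form) auto
  \<comment> \<open>Positivity of the remainder allows the other \<open>k\<close> vectors to be
    added, which completes the trace.\<close>
  also have "\<dots> \<le> (\<Sum>q<n. \<Sum>i<n. \<Sum>j<n. w q i * w q j * (Q i j / real n))"
    by (intro sum_mono2 Q_nonneg) auto
  also have "\<dots> = (\<Sum>i<n. Q i i / real n)"
    by (rule frame_trace[OF w])
  finally show ?thesis by (simp add: Q_def power2_eq_square mult.assoc)
qed

lemma gram_tail_expectation:
  assumes "prob_space M" and S: "\<And>i. i < n \<Longrightarrow> S i \<in> measurable M \<mu>"
    and distr: "\<And>i. i < n \<Longrightarrow> distr M \<mu> (S i) = \<mu>" and k: "1 \<le> k" "k \<le> n"
  shows "ennreal (\<integral>\<omega>. gram_tail K n S k \<omega> \<partial>M) \<le> (\<Sum>p. ennreal (L (k - 1 + p)))"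
proof -
  interpret M: prob_space M by fact
  define g where "g x = K x x - (\<Sum>p<k-1. L p * (u p x)\<^sup>2)" for x
  have gc: "continuous_on X g" unfolding g_def by (rule remainder_diag_cont)
  have g_int: "integrable M (\<lambda>\<omega>. g (S i \<omega>))" and g_eq: "(\<integral>\<omega>. g (S i \<omega>) \<partial>M) = (\<integral>x. g x \<partial>\<mu>)"
    if "i < n" for i
    using integrable_distr[OF S[OF that], of g] integral_distr[OF S[OF that] continuous_measurable[OF gc]]
      continuous_integrable[OF gc] distr[OF that] by simp_all
  \<comment> \<open>The bound by the remainder requires sample points in the support, which holds
    almost surely.\<close>
  have "AE \<omega> in M. S i \<omega> \<in> measure_support \<mu>" if "i < n" for i
    by (rule AE_distrD[OF S[OF that]], unfold distr[OF that], rule AE_support)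
  then have "AE \<omega> in M. \<forall>i\<in>{..<n}. S i \<omega> \<in> measure_support \<mu>"
    by (intro AE_finite_allI) auto
  then have "AE \<omega> in M. gram_tail K n S k \<omega> \<le> (\<Sum>i<n. g (S i \<omega>) / real n)"
  proof eventually_elim
    case (elim \<omega>)
    then show ?case
      unfolding gram_tail_eq[OF k(1)] g_def using k by (intro gram_tail_le_remainder) auto
  qed
  then have "(\<integral>\<omega>. gram_tail K n S k \<omega> \<partial>M) \<le> (\<integral>\<omega>. (\<Sum>i<n. g (S i \<omega>) / real n) \<partial>M)"
    using g_int
    by (intro integral_mono_AE gram_tail_integrable \<open>prob_space M\<close> S k Bochner_Integration.integrable_sum) auto
  also have "\<dots> = (\<Sum>i<n. (\<integral>x. g x \<partial>\<mu>) / real n)"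
    using g_int g_eq by (subst Bochner_Integration.integral_sum) auto
  also have "\<dots> = (\<integral>x. g x \<partial>\<mu>)" using k by simp
  finally have "ennreal (\<integral>\<omega>. gram_tail K n S k \<omega> \<partial>M) \<le> ennreal (\<integral>x. g x \<partial>\<mu>)"
    by (rule ennreal_leI)
  also have "\<dots> = (\<Sum>p. ennreal (L (k - 1 + p) * (\<integral>x. (u (k - 1 + p) x)\<^sup>2 \<partial>\<mu>)))"
    unfolding g_def by (rule remainder_trace[OF mercer_space_axioms AE_support])
  also have "\<dots> = (\<Sum>p. ennreal (L (k - 1 + p)))"
  proof (intro suminf_cong arg_cong[where f = ennreal])
    fix p
    have "(\<integral>x. (u (k - 1 + p) x)\<^sup>2 \<partial>\<mu>) = ip (u (k - 1 + p)) (u (k - 1 + p))"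
      by (simp add: ip_def power2_eq_square)
    then show "L (k - 1 + p) * (\<integral>x. (u (k - 1 + p) x)\<^sup>2 \<partial>\<mu>) = L (k - 1 + p)"
      using ortho[of "k - 1 + p" "k - 1 + p"] L_nonneg[of "k - 1 + p"] by auto
  qed
  finally show ?thesis .
qed

end

section \<open>The main theorem\<close>

text \<open>There are \<open>r + 1\<close> pairs with sum \<open>r\<close>; this is the origin of
  the factor \<open>i - k + 1\<close> in the decay condition. The exchange of sums is monotone
  convergence for the counting measure.\<close>

lemma ennreal_double_suminf:
  fixes f :: "nat \<Rightarrow> ennreal"
  shows "(\<Sum>p. \<Sum>q. f (p + q)) = (\<Sum>r. of_nat (Suc r) * f r)"
proof -
  define g where "g p r = (if p \<le> r then f r else 0)" for p r
  have "(\<Sum>q. f (p + q)) = (\<Sum>r. g p r)" for p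
  proof -
    have "(\<Sum>r. g p r) = (\<Sum>q. g p (q + p)) + (\<Sum>r<p. g p r)"
      by (rule suminf_offset) simp
    also have "(\<Sum>r<p. g p r) = 0" by (intro sum.neutral) (auto simp: g_def)
    finally show ?thesis by (simp add: g_def add.commute)
  qed
  then have "(\<Sum>p. \<Sum>q. f (p + q)) = (\<integral>\<^sup>+p. (\<Sum>r. g p r) \<partial>count_space UNIV)"
    by (simp add: nn_integral_count_space_nat)
  also have "\<dots> = (\<Sum>r. \<integral>\<^sup>+p. g p r \<partial>count_space UNIV)"
    by (rule nn_integral_suminf) simp
  also have "\<dots> = (\<Sum>r. of_nat (Suc r) * f r)"
  proof (rule suminf_cong)
    fix r
    have "(\<integral>\<^sup>+p. g p r \<partial>count_space UNIV) = (\<Sum>p\<in>{..r}. g p r)"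
      unfolding nn_integral_count_space_nat by (rule suminf_finite) (auto simp: g_def)
    then show "(\<integral>\<^sup>+p. g p r \<partial>count_space UNIV) = of_nat (Suc r) * f r"
      by (simp add: g_def)
  qed
  finally show ?thesis .
qed

text \<open>Multiplication by the denominator is delicate only where it is 0: there a finite ratio
  forces every numerator to be 0.\<close>

lemma decay_ratio_bound:
  assumes "decay_ratio \<rho> l \<phi> k \<noteq> \<top>"
  shows "(\<Sum>p. ennreal (real (p + 1) * l (k + p) * sq_norm \<rho> (\<phi> (k + p))))
    \<le> decay_ratio \<rho> l \<phi> k * ennreal (l k * sq_norm \<rho> (\<phi> k))"
proof -
  define f where "f p = ennreal (real (p + 1) * l (k + p) * sq_norm \<rho> (\<phi> (k + p)))" for p
  define c where "c = ennreal (l k * sq_norm \<rho> (\<phi> k))"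
  have d: "decay_ratio \<rho> l \<phi> k = (\<Sum>p. f p / c)"
    by (simp add: decay_ratio_def f_def c_def)
  have "f p \<le> f p / c * c" for p
  proof (cases "c = 0")
    case True
    have "f p / c \<le> (\<Sum>p. f p / c)"
      using sum_le_suminf[of "\<lambda>p. f p / c" "{p}"] by simp
    then have "f p / c \<noteq> \<top>" using assms unfolding d by (auto simp: top_unique)
    then have "f p = 0" using True by (auto split: if_splits)
    then show ?thesis by simp
  next
    case False
    then show ?thesis
      using ennreal_divide_times[of "f p" c c] by (simp add: c_def ennreal_mult_divide_eq)
  qed
  then have "(\<Sum>p. f p) \<le> (\<Sum>p. f p / c * c)" by (intro suminf_le) auto
  also have "\<dots> = (\<Sum>p. f p / c) * c" by (rule ennreal_suminf_multc)
  finally show ?thesis unfolding d f_def c_def .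
qed

text \<open>The eigenvalue equation is given almost everywhere; both sides are continuous and the
  support is \<open>X\<close>, so it holds at every point.\<close>

lemma eigenfunction_system:
  assumes "mercer_space X K P" and supp: "measure_support P = X"
    and l: "eigenvalue_seq K P l" and \<phi>: "eigenfunction_seq K P l \<phi>"
  shows "eigensystem X K P (\<lambda>j. l (Suc j)) (\<lambda>j x. if 0 < l (Suc j) then \<phi> (Suc j) x else 0)"
proof -
  interpret mercer_space X K P by fact
  show ?thesis
  proof (rule eigensystemI[OF l])
    fix j :: nat assume j: "1 \<le> j" "0 < l j"
    have c: "continuous_on X (\<phi> j)" and ae: "AE x in P. T (\<phi> j) x = l j * \<phi> j x"
      using \<phi> j by (auto simp: eigenfunction_seq_def eigenspace_def)
    define h where "h x = T (\<phi> j) x - l j * \<phi> j x" for x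
    have hc: "continuous_on X h" unfolding h_def by (intro continuous_intros c)
    have "ip h h = 0"
      unfolding ip_def using ae by (intro integral_eq_zero_AE) (auto simp: h_def elim!: eventually_mono)
    then have "h x = 0" if "x \<in> X" for x
      using zero_on_support[OF hc] that supp by simp
    then show "\<phi> j \<in> eigenfunctions (l j)"
      using c by (simp add: eigenfunctions_def h_def)
  qed (use \<phi> in \<open>auto simp: eigenfunction_seq_def ip_def\<close>)
qed

theorem theorem1:
  fixes X :: "(real ^ 'd) set"
    and K :: "real ^ 'd \<Rightarrow> real ^ 'd \<Rightarrow> real"
    and P \<rho> :: "(real ^ 'd) measure"
    and l l\<rho> :: "nat \<Rightarrow> real"
    and \<phi> :: "nat \<Rightarrow> real ^ 'd \<Rightarrow> real"
  assumes "compact X"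
    and "mercer_kernel X K"
    and "borel_prob_on X P" and "measure_support P = X"
    and "borel_prob_on X \<rho>"
    and "eigenvalue_seq K P l" and "eigenfunction_seq K P l \<phi>"
    and "eigenvalue_seq K \<rho> l\<rho>"
    and "one_to_one_op K P"
    and "absolutely_continuous P \<rho>"
    and "\<exists>b::real. AE x in P. RN_deriv P \<rho> x \<le> ennreal b"
  shows
    "(\<forall>m\<ge>1. ennreal (l\<rho> m) \<le> (\<Sum>p. ennreal (l (m + p) * sq_norm \<rho> (\<phi> (m + p))))) \<and>
     (\<forall>(M :: 'w measure) (S :: nat \<Rightarrow> 'w \<Rightarrow> real ^ 'd) n k.
        1 \<le> k \<longrightarrow> k \<le> n \<longrightarrow> iid_sample M \<rho> n S \<longrightarrow>
        integrable M (gram_tail K n S k) \<and>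
        ennreal (\<integral>\<omega>. gram_tail K n S k \<omega> \<partial>M) \<le> (\<Sum>p. ennreal (l\<rho> (k + p)))) \<and>
     (\<forall>I \<subseteq> {1..}. (\<Squnion>k\<in>I. decay_ratio \<rho> l \<phi> k) < \<infinity> \<longrightarrow>
        (\<exists>C>0. \<forall>k\<in>I.
           (\<Sum>p. ennreal (l\<rho> (k + p))) \<le> ennreal (C * (l k * sq_norm \<rho> (\<phi> k)))))"
proof -
  interpret P: eigensystem X K P "\<lambda>j. l (Suc j)" "\<lambda>j x. if 0 < l (Suc j) then \<phi> (Suc j) x else 0"
    by (rule eigenfunction_system) (unfold_locales, fact+)
  interpret \<rho>: mercer_space X K \<rho>
    by unfold_locales fact+
  obtain \<psi> where \<psi>: "eigensystem X K \<rho> (\<lambda>j. l\<rho> (Suc j)) \<psi>"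
    using \<rho>.eigensystem_exists[OF \<open>eigenvalue_seq K \<rho> l\<rho>\<close>] by blast
  interpret \<rho>: eigensystem X K \<rho> "\<lambda>j. l\<rho> (Suc j)" \<psi> by fact
  define a where "a i = l i * sq_norm \<rho> (\<phi> i)" for i
  have 1: "ennreal (l\<rho> m) \<le> (\<Sum>p. ennreal (a (m + p)))" if m: "1 \<le> m" for m
  proof -
    have "l\<rho> (Suc (m - 1)) \<le> (\<integral>x. K x x - (\<Sum>p<m-1. l (Suc p) * (if 0 < l (Suc p) then \<phi> (Suc p) x else 0)\<^sup>2) \<partial>\<rho>)"
      using eigenvalue_seq_antimono[OF \<open>eigenvalue_seq K \<rho> l\<rho>\<close>] \<open>measure_support P = X\<close>
      by (intro P.eigenvalue_le_trace[OF \<psi>]) auto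
    then have "ennreal (l\<rho> m) \<le> ennreal (\<integral>x. K x x - (\<Sum>p<m-1. l (Suc p) * (if 0 < l (Suc p) then \<phi> (Suc p) x else 0)\<^sup>2) \<partial>\<rho>)"
      using m by (intro ennreal_leI) simp
    also have "\<dots> = (\<Sum>p. ennreal (l (Suc (m - 1 + p)) *
        (\<integral>x. (if 0 < l (Suc (m - 1 + p)) then \<phi> (Suc (m - 1 + p)) x else 0)\<^sup>2 \<partial>\<rho>)))"
      using \<open>measure_support P = X\<close>
      by (intro P.remainder_trace[OF \<rho>.mercer_space_axioms] AE_I2) simp
    also have "\<dots> = (\<Sum>p. ennreal (a (m + p)))"
    proof (intro suminf_cong arg_cong[where f = ennreal])
      fix p
      have eq: "Suc (m - 1 + p) = m + p" using m by simp
      have "l (m + p) = 0" if "\<not> 0 < l (m + p)"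
        using that P.L_nonneg[of "m - 1 + p"] unfolding eq by simp
      then show "l (Suc (m - 1 + p)) * (\<integral>x. (if 0 < l (Suc (m - 1 + p)) then \<phi> (Suc (m - 1 + p)) x else 0)\<^sup>2 \<partial>\<rho>)
          = a (m + p)"
        unfolding eq a_def sq_norm_def by (cases "0 < l (m + p)") simp_all
    qed
    finally show ?thesis .
  qed
  have 2: "integrable M (gram_tail K n S k) \<and>
      ennreal (\<integral>\<omega>. gram_tail K n S k \<omega> \<partial>M) \<le> (\<Sum>p. ennreal (l\<rho> (k + p)))"
    if k: "1 \<le> k" "k \<le> n" and iid: "iid_sample M \<rho> n S"
    for M :: "'w measure" and S :: "nat \<Rightarrow> 'w \<Rightarrow> real ^ 'd" and n k
  proof -
    have M: "prob_space M" and distr: "\<And>i. i < n \<Longrightarrow> distr M \<rho> (S i) = \<rho>"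
      using iid by (auto simp: iid_sample_def)
    have S: "S i \<in> measurable M \<rho>" if "i < n" for i
      using iid that M by (auto simp: iid_sample_def prob_space.indep_vars_def)
    have "k - 1 + p = k + p - 1" "Suc (k - 1 + p) = k + p" for p using k by auto
    then show ?thesis
      using \<rho>.gram_tail_integrable[OF M S k] \<rho>.gram_tail_expectation[OF M S distr k] by simp
  qed
  have 3: "\<exists>C>0. \<forall>k\<in>I. (\<Sum>p. ennreal (l\<rho> (k + p))) \<le> ennreal (C * (l k * sq_norm \<rho> (\<phi> k)))"
    if I: "I \<subseteq> {1..}" and fin: "(\<Squnion>k\<in>I. decay_ratio \<rho> l \<phi> k) < \<infinity>" for I
  proof -
    define B where "B = (\<Squnion>k\<in>I. decay_ratio \<rho> l \<phi> k)"
    \<comment> \<open>The supremum may be 0; the summand 1 makes the constant positive.\<close>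
    define C where "C = enn2real B + 1"
    have B: "B = ennreal (enn2real B)" using fin by (simp add: B_def)
    show ?thesis
    proof (intro exI[of _ C] conjI ballI)
      show "0 < C" unfolding C_def by (simp add: add_nonneg_pos)
      fix k assume k: "k \<in> I"
      then have k1: "1 \<le> k" using I by auto
      have nonneg: "0 \<le> a (k + p)" for p
      proof -
        have "0 \<le> l (k + p)" using P.L_nonneg[of "k + p - 1"] k1 by simp
        then show ?thesis by (simp add: a_def sq_norm_def)
      qed
      have le_B: "decay_ratio \<rho> l \<phi> k \<le> B" unfolding B_def using k by (rule SUP_upper)
      \<comment> \<open>The eigenvalue bound is applied at each index \<open>k + p\<close>, which
        produces the double sum.\<close>
      have "(\<Sum>p. ennreal (l\<rho> (k + p))) \<le> (\<Sum>p. \<Sum>q. ennreal (a (k + p + q)))"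
        using k1 by (intro suminf_le 1) auto
      also have "\<dots> = (\<Sum>r. of_nat (Suc r) * ennreal (a (k + r)))"
        using ennreal_double_suminf[of "\<lambda>r. ennreal (a (k + r))"] by (simp add: add.assoc)
      also have "\<dots> = (\<Sum>p. ennreal (real (p + 1) * l (k + p) * sq_norm \<rho> (\<phi> (k + p))))"
      proof (rule suminf_cong)
        fix p
        have "of_nat (Suc p) * ennreal (a (k + p)) = ennreal (real (Suc p)) * ennreal (a (k + p))"
          by (simp only: ennreal_of_nat_eq_real_of_nat)
        also have "\<dots> = ennreal (real (Suc p) * a (k + p))"
          using nonneg by (simp only: ennreal_mult of_nat_0_le_iff)
        finally show "of_nat (Suc p) * ennreal (a (k + p))
            = ennreal (real (p + 1) * l (k + p) * sq_norm \<rho> (\<phi> (k + p)))"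
          by (simp add: a_def mult.assoc)
      qed
      also have "\<dots> \<le> decay_ratio \<rho> l \<phi> k * ennreal (a k)"
        unfolding a_def using le_B fin by (intro decay_ratio_bound) (auto simp: B_def top_unique)
      also have "\<dots> \<le> B * ennreal (a k)"
        by (intro mult_right_mono le_B) simp
      also have "\<dots> = ennreal (enn2real B * a k)"
        using nonneg[of 0] by (subst B) (simp add: ennreal_mult)
      also have "\<dots> \<le> ennreal (C * a k)"
        using nonneg[of 0] by (intro ennreal_leI mult_right_mono) (auto simp: C_def)
      finally show "(\<Sum>p. ennreal (l\<rho> (k + p))) \<le> ennreal (C * (l k * sq_norm \<rho> (\<phi> k)))"
        by (simp only: a_def)
    qed
  qed
  show ?thesis using 1 2 3 unfolding a_def by blast
qed

end
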